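(* Let $\tau$ be an infinite cardinal number and let $X$ be a space. Then the following conditions are equivalent: (a) $X$ is $\tau$-collectionwise normal. (b) If $\Phi:X\to \mathscr{C}'_{\mathbf c}(\mathbb{J}(\tau))$ is l.s.c., $k\in\mathbb{N}$ and $\theta:X\to \mathscr{C}_k(\mathbb{J}(\tau))$ is u.s.c. with $\theta\leqslant\Phi$, then there exists a continuous mapping $\varphi:X\to \mathscr{C}_{\mathbf c}(\mathbb{J}(\tau))$ such that $\theta\leqslant\varphi\leqslant \Phi$.
   Context: All spaces are infinite Hausdorff topological spaces. For a set $Y$, $2^Y$ denotes the family of all nonempty subsets of $Y$. For a space $Y$: $\mathscr{C}(Y)$ is the family of all nonempty compact subsets of $Y$; $\mathscr{C}_{\mathbf c}(Y)$ is the family of connected members of $\mathscr{C}(Y)$; for connected $Y$, $\mathscr{C}'_{\mathbf c}(Y)=\mathscr{C}_{\mathbf c}(Y)\cup\{Y\}$; for $k\in\mathbb{N}$ (a positive integer), $\mathscr{C}_k(Y)=\{S\in 2^Y:|S|\leq k\}$. A mapping $\Phi:X\to 2^Y$ is l.s.c. (lower semi-continuous) if $\Phi^{-1}(U)=\{x\in X:\Phi(x)\cap U\neq\varnothing\}$ is open in $X$ for every open $U\subseteq Y$; it is u.s.c. (upper semi-continuous) if $\Phi^{-1}(F)$ is closed in $X$ for every closed $F\subseteq Y$; it is continuous if it is both l.s.c. and u.s.c. For $\theta,\Phi:X\to 2^Y$, $\theta\leqslant\Phi$ means $\theta(x)\subseteq\Phi(x)$ for all $x\in X$. A space $X$ is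 $\tau$-collectionwise normal if every discrete family $\mathscr{F}$ of closed subsets of $X$ with $|\mathscr{F}|\leq\tau$ admits a discrete family $\{U_F:F\in\mathscr{F}\}$ of open subsets of $X$ such that $F\subseteq U_F$ for each $F\in\mathscr{F}$. For a set $\mathscr{A}$, the metrizable hedgehog $\mathbb{J}(\mathscr{A})$ is the set $\{0\}\cup (0,1]\times\mathscr{A}$ with the metric $d(0,\langle s,\alpha\rangle)=s$, $d(\langle s,\alpha\rangle,\langle t,\beta\rangle)=|s-t|$ if $\alpha=\beta$, and $=s+t$ if $\alpha\neq\beta$. $\mathbb{J}(\tau)$ is $\mathbb{J}(\mathscr{A})$ for a set $\mathscr{A}$ of cardinality $\tau$; it is connected. *)

theory Defs
  imports "HOL-Analysis.Analysis"
begin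

unbundle cardinal_syntax

section \<open>Hyperspaces\<close>

definition compact_sets :: "'b topology \<Rightarrow> 'b set set" where
  "compact_sets Y = {S. S \<noteq> {} \<and> compactin Y S}"

definition connected_compact_sets :: "'b topology \<Rightarrow> 'b set set" where
  "connected_compact_sets Y = {S \<in> compact_sets Y. connectedin Y S}"

definition connected_compact_sets' :: "'b topology \<Rightarrow> 'b set set" where
  "connected_compact_sets' Y = connected_compact_sets Y \<union> {topspace Y}"

text \<open>Finiteness has to be required separately, because infinite sets have \<^term>\<open>card\<close> 0.\<close>

definition sets_card_le :: "nat \<Rightarrow> 'b topology \<Rightarrow> 'b set set" where
  "sets_card_le k Y = {S. S \<noteq> {} \<and> S \<subseteq> topspace Y \<and> finite S \<and> card S \<le> k}"


section \<open>Set-valued mappings\<close>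

text \<open>
  A mapping from a space \<open>X\<close> into a family \<open>\<S>\<close> of nonempty subsets of a space is a function in
  \<open>topspace X \<rightarrow> \<S>\<close>; its values outside \<open>topspace X\<close> are irrelevant to all notions below.
\<close>

definition lsc_map :: "'a topology \<Rightarrow> 'b topology \<Rightarrow> ('a \<Rightarrow> 'b set) \<Rightarrow> bool" where
  "lsc_map X Y \<Phi> \<longleftrightarrow> (\<forall>U. openin Y U \<longrightarrow> openin X {x \<in> topspace X. \<Phi> x \<inter> U \<noteq> {}})"

definition usc_map :: "'a topology \<Rightarrow> 'b topology \<Rightarrow> ('a \<Rightarrow> 'b set) \<Rightarrow> bool" where
  "usc_map X Y \<Phi> \<longleftrightarrow> (\<forall>F. closedin Y F \<longrightarrow> closedin X {x \<in> topspace X. \<Phi> x \<inter> F \<noteq> {}})"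

definition continuous_set_map :: "'a topology \<Rightarrow> 'b topology \<Rightarrow> ('a \<Rightarrow> 'b set) \<Rightarrow> bool" where
  "continuous_set_map X Y \<Phi> \<longleftrightarrow> lsc_map X Y \<Phi> \<and> usc_map X Y \<Phi>"

definition submap :: "'a topology \<Rightarrow> ('a \<Rightarrow> 'b set) \<Rightarrow> ('a \<Rightarrow> 'b set) \<Rightarrow> bool" where
  "submap X \<theta> \<Phi> \<longleftrightarrow> (\<forall>x \<in> topspace X. \<theta> x \<subseteq> \<Phi> x)"


section \<open>Collectionwise normality\<close>

text \<open>
  Discreteness is a property of the indexed family: members with different indices count as
  different even if they are equal as sets. This matters for the open expansions
  \<open>{U\<^sub>F : F \<in> \<F>}\<close> below, which would otherwise always exist (take \<open>U\<^sub>F\<close> to be the whole space).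
\<close>

definition discrete_family :: "'a topology \<Rightarrow> ('i \<Rightarrow> 'a set) \<Rightarrow> 'i set \<Rightarrow> bool" where
  "discrete_family X U I \<longleftrightarrow>
     (\<forall>i\<in>I. U i \<subseteq> topspace X) \<and>
     (\<forall>x \<in> topspace X. \<exists>V. openin X V \<and> x \<in> V \<and>
        (\<forall>i\<in>I. \<forall>j\<in>I. U i \<inter> V \<noteq> {} \<and> U j \<inter> V \<noteq> {} \<longrightarrow> i = j))"

definition collectionwise_normal :: "'t rel \<Rightarrow> 'a topology \<Rightarrow> bool" where
  "collectionwise_normal \<tau> X \<longleftrightarrow>
     (\<forall>\<F>. (\<forall>F\<in>\<F>. closedin X F) \<and> discrete_family X (\<lambda>F. F) \<F> \<and> |\<F>| \<le>o \<tau> \<longrightarrow>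
        (\<exists>U. (\<forall>F\<in>\<F>. openin X (U F) \<and> F \<subseteq> U F) \<and> discrete_family X U \<F>))"


section \<open>The metrizable hedgehog\<close>

text \<open>
  \<open>Spine s \<alpha>\<close> stands for the point \<open>\<langle>s, \<alpha>\<rangle>\<close>; only those with \<open>0 < s \<le> 1\<close> and \<open>\<alpha> \<in> A\<close> are points of
  the hedgehog on \<open>A\<close>.
\<close>

datatype 'c hedgehog = Origin | Spine real 'c

definition hedgehog_points :: "'c set \<Rightarrow> 'c hedgehog set" where
  "hedgehog_points A = {Origin} \<union> {Spine s \<alpha> | s \<alpha>. 0 < s \<and> s \<le> 1 \<and> \<alpha> \<in> A}"

text \<open>
  The absolute values around single parameters have no effect on \<open>hedgehog_points A\<close>. They are there
  because \<^locale>\<open>Metric_space\<close> requires nonnegativity on the whole type.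
\<close>

fun hedgehog_dist :: "'c hedgehog \<Rightarrow> 'c hedgehog \<Rightarrow> real" where
  "hedgehog_dist Origin Origin = 0"
| "hedgehog_dist Origin (Spine t \<beta>) = \<bar>t\<bar>"
| "hedgehog_dist (Spine s \<alpha>) Origin = \<bar>s\<bar>"
| "hedgehog_dist (Spine s \<alpha>) (Spine t \<beta>) = (if \<alpha> = \<beta> then \<bar>s - t\<bar> else \<bar>s\<bar> + \<bar>t\<bar>)"

lemma Metric_space_hedgehog: "Metric_space (hedgehog_points A) hedgehog_dist"
proof
  fix x y z :: "'a hedgehog"
  show "0 \<le> hedgehog_dist x y" by (cases x; cases y) auto
  show "hedgehog_dist x y = hedgehog_dist y x" by (cases x; cases y) auto
  show "hedgehog_dist x y = 0 \<longleftrightarrow> x = y" if "x \<in> hedgehog_points A" "y \<in> hedgehog_points A"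
    using that by (cases x; cases y) (auto simp: hedgehog_points_def)
  show "hedgehog_dist x z \<le> hedgehog_dist x y + hedgehog_dist y z"
    by (cases x; cases y; cases z) auto
qed

definition hedgehog :: "'c set \<Rightarrow> 'c hedgehog topology" where
  "hedgehog A = Metric_space.mtopology (hedgehog_points A) hedgehog_dist"

lemma topspace_hedgehog [simp]: "topspace (hedgehog A) = hedgehog_points A"
  by (simp add: hedgehog_def Metric_space.topspace_mtopology[OF Metric_space_hedgehog])

lemma Hausdorff_space_hedgehog: "Hausdorff_space (hedgehog A)"
  by (simp add: hedgehog_def Metric_space.Hausdorff_space_mtopology[OF Metric_space_hedgehog])

end

theory Submission
  imports Defs
begin

text \<open>
  A compact connected set \<open>S\<close> in the hedgehog is determined by the maxima over \<open>S\<close> of the signed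
  heights \<open>level \<beta>\<close>, which measure the distance to the origin positively along the spine \<open>\<beta>\<close> and
  negatively elsewhere. The maximum of \<open>level \<beta>\<close> over \<open>\<theta> x\<close> is upper semicontinuous in \<open>x\<close>, the
  supremum over \<open>\<Phi> x\<close> is lower semicontinuous, so the Katetov-Tong theorem inserts continuous
  functions \<open>g \<beta>\<close>. The levels \<open>g \<beta> x\<close> prescribe a subtree \<open>\<phi> x\<close> with \<open>\<theta> x \<subseteq> \<phi> x \<subseteq> \<Phi> x\<close>. For \<open>\<phi>\<close> to
  be compact-valued and continuous, all but finitely many \<open>g \<beta>\<close> must locally be small; this is
  arranged by expanding the closed sets on which \<open>\<theta>\<close> reaches a given height along \<open>\<beta>\<close>, a locally
  finite family of order at most \<open>k\<close>, to a locally finite open family.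

  Conversely, for a discrete closed family \<open>\<F>\<close> indexed by spines, let \<open>\<theta>\<close> be \<open>{Origin, Spine 1 F}\<close>
  and \<open>\<Phi>\<close> the segment between these points on \<open>F\<close>, and \<open>{Origin}\<close> and the whole hedgehog elsewhere.
  An open expansion consists of the points \<open>x\<close> at which \<open>\<phi> x\<close> reaches high along exactly one spine.
\<close>

section \<open>Insertion of continuous functions in normal spaces\<close>

definition usc_fun :: "'a topology \<Rightarrow> ('a \<Rightarrow> real) \<Rightarrow> bool" where
  "usc_fun X f \<longleftrightarrow> (\<forall>c. closedin X {x \<in> topspace X. c \<le> f x})"

definition lsc_fun :: "'a topology \<Rightarrow> ('a \<Rightarrow> real) \<Rightarrow> bool" where
  "lsc_fun X f \<longleftrightarrow> (\<forall>c. openin X {x \<in> topspace X. c < f x})"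

lemma continuous_imp_usc_fun:
  assumes "continuous_map X euclideanreal f" shows "usc_fun X f"
  using assms unfolding usc_fun_def continuous_map_upper_lower_semicontinuous_le by blast

lemma continuous_imp_lsc_fun:
  assumes "continuous_map X euclideanreal f" shows "lsc_fun X f"
  using assms unfolding lsc_fun_def continuous_map_upper_lower_semicontinuous_lt by blast

lemma usc_fun_max:
  assumes "usc_fun X f" "usc_fun X g" shows "usc_fun X (\<lambda>x. max (f x) (g x))"
proof -
  have "{x \<in> topspace X. c \<le> max (f x) (g x)} =
      {x \<in> topspace X. c \<le> f x} \<union> {x \<in> topspace X. c \<le> g x}" for c
    by auto
  then show ?thesis using assms by (simp add: usc_fun_def closedin_Un)
qed

lemma lsc_fun_min:
  assumes "lsc_fun X f" "lsc_fun X g" shows "lsc_fun X (\<lambda>x. min (f x) (g x))"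
proof -
  have "{x \<in> topspace X. c < min (f x) (g x)} =
      {x \<in> topspace X. c < f x} \<inter> {x \<in> topspace X. c < g x}" for c
    by auto
  then show ?thesis using assms by (simp add: lsc_fun_def openin_Int)
qed

text \<open>A sum exceeds \<open>c\<close> exactly when some real \<open>t\<close> satisfies
  \<open>t < f x\<close> and \<open>c - t < g x\<close>, so its strict superlevel set is a union of
  intersections of open sets.\<close>

lemma lsc_fun_add:
  assumes f: "lsc_fun X f" and g: "lsc_fun X g" shows "lsc_fun X (\<lambda>x. f x + g x)"
  unfolding lsc_fun_def
proof
  fix c
  have eq: "{x \<in> topspace X. c < f x + g x} =
      (\<Union>t. {x \<in> topspace X. t < f x} \<inter> {x \<in> topspace X. c - t < g x})" (is "?L = ?R")
  proof
    show "?L \<subseteq> ?R"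
    proof
      fix x assume x: "x \<in> ?L"
      then have "c - g x < f x" by auto
      then obtain t where "c - g x < t" "t < f x" using dense by blast
      with x show "x \<in> ?R" by auto
    qed
  qed auto
  show "openin X {x \<in> topspace X. c < f x + g x}"
    unfolding eq using f g unfolding lsc_fun_def by (intro openin_Union) (auto intro: openin_Int)
qed

lemma lsc_fun_cmult:
  assumes f: "lsc_fun X f" and "a > 0" shows "lsc_fun X (\<lambda>x. a * f x)"
proof -
  have "c < a * f x \<longleftrightarrow> c / a < f x" for c x
    using \<open>a > 0\<close> by (simp add: field_simps)
  then show ?thesis using f by (simp add: lsc_fun_def)
qed

text \<open>Each step raises the approximating function by \<open>\<delta>\<close> on \<open>{x. c \<le> f x}\<close> and not at all on
  \<open>{x. g x \<le> c - \<delta>}\<close>, for the successive levels \<open>c\<close>.\<close>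

lemma insertion_staircase:
  assumes X: "normal_space X" and f: "usc_fun X f" and g: "lsc_fun X g"
    and fg: "\<And>x. x \<in> topspace X \<Longrightarrow> a \<le> f x \<and> f x \<le> g x" and "\<delta> > 0"
  shows "\<exists>h. continuous_map X euclideanreal h \<and> (\<forall>x\<in>topspace X.
     min (f x - \<delta>) (a + real n * \<delta>) \<le> h x \<and> h x \<le> min (g x + \<delta>) (a + real n * \<delta>))"
proof (induction n)
  case 0
  have "continuous_map X euclideanreal (\<lambda>x. a)" by simp
  then show ?case using fg \<open>\<delta> > 0\<close> by (intro exI[of _ "\<lambda>x. a"]) fastforce
next
  case (Suc n)
  define c where "c = a + real n * \<delta>"
  obtain h where h: "continuous_map X euclideanreal h"
    and hb: "\<And>x. x \<in> topspace X \<Longrightarrow> min (f x - \<delta>) c \<le> h x \<and> h x \<le> min (g x + \<delta>) c"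
    using Suc unfolding c_def by blast
  have 1: "closedin X {x \<in> topspace X. c + \<delta> \<le> f x}"
    using f by (simp add: usc_fun_def)
  have "{x \<in> topspace X. g x \<le> c} = topspace X - {x \<in> topspace X. c < g x}" by auto
  then have 2: "closedin X {x \<in> topspace X. g x \<le> c}"
    using g unfolding lsc_fun_def by (metis (no_types, lifting) closedin_diff closedin_topspace)
  have "disjnt {x \<in> topspace X. g x \<le> c} {x \<in> topspace X. c + \<delta> \<le> f x}"
    using fg \<open>\<delta> > 0\<close> by (force simp: disjnt_iff)
  then obtain u where u: "continuous_map X (top_of_set {0..\<delta>}) u"
    and u0: "u ` {x \<in> topspace X. g x \<le> c} \<subseteq> {0}"
    and u1: "u ` {x \<in> topspace X. c + \<delta> \<le> f x} \<subseteq> {\<delta>}"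
    using Urysohn_lemma[OF X 2 1, of 0 \<delta>] \<open>\<delta> > 0\<close> by auto
  have ub: "0 \<le> u x \<and> u x \<le> \<delta>" if "x \<in> topspace X" for x
    using u that unfolding continuous_map_in_subtopology by fastforce
  have "continuous_map X euclideanreal (\<lambda>x. h x + u x)"
    using h u by (intro continuous_intros) (auto simp: continuous_map_in_subtopology)
  \<comment> \<open>Lower bound: where \<open>c + \<delta> \<le> f x\<close>, \<open>h x\<close> is
    already at least \<open>c\<close> and \<open>u x = \<delta>\<close>; elsewhere
    \<open>f x - \<delta> < c\<close>, so the bound for \<open>h x\<close> suffices. Upper bound:
    \<open>u x\<close> can be nonzero only where \<open>c < g x\<close>, and there
    \<open>c + \<delta>\<close> lies below \<open>g x + \<delta>\<close>.\<close>
  moreover have "min (f x - \<delta>) (c + \<delta>) \<le> h x + u x \<and> h x + u x \<le> min (g x + \<delta>) (c + \<delta>)"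
    if x: "x \<in> topspace X" for x
  proof -
    have "g x \<le> c \<Longrightarrow> u x = 0" "c + \<delta> \<le> f x \<Longrightarrow> u x = \<delta>" using u0 u1 x by auto
    then show ?thesis using hb[OF x] ub[OF x] fg[OF x] by (smt (verit))
  qed
  moreover have "a + real (Suc n) * \<delta> = c + \<delta>" by (simp add: c_def algebra_simps)
  ultimately show ?case by (intro exI[of _ "\<lambda>x. h x + u x"]) simp
qed

section \<open>The Katetov-Tong theorem by successive approximation\<close>

lemma approximate_insertion:
  assumes X: "normal_space X" and f: "usc_fun X f" and g: "lsc_fun X g"
    and fg: "\<And>x. x \<in> topspace X \<Longrightarrow> a \<le> f x \<and> f x \<le> g x \<and> g x \<le> b" and "\<delta> > 0"
  shows "\<exists>h. continuous_map X euclideanreal h \<and> (\<forall>x\<in>topspace X. f x - \<delta> \<le> h x \<and> h x \<le> g x + \<delta>)"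
proof -
  \<comment> \<open>Once the top of the staircase is above \<open>b\<close>, its truncation no
    longer weakens the lower bound \<open>f x - \<delta>\<close>.\<close>
  obtain n :: nat where "(b - a) / \<delta> \<le> real n" using real_arch_simple by blast
  then have n: "b \<le> a + real n * \<delta>" using \<open>\<delta> > 0\<close> by (simp add: field_simps)
  obtain h where "continuous_map X euclideanreal h" "\<forall>x\<in>topspace X.
     min (f x - \<delta>) (a + real n * \<delta>) \<le> h x \<and> h x \<le> min (g x + \<delta>) (a + real n * \<delta>)"
    using insertion_staircase[OF X f g _ \<open>\<delta> > 0\<close>, of a n] fg by blast
  then show ?thesis using fg n \<open>\<delta> > 0\<close> by (intro exI[of _ h]) (smt (verit, ccfv_SIG))
qed

text \<open>Raising \<open>f\<close> to at least \<open>h - \<delta>\<close> and lowering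
  \<open>g\<close> to at most \<open>h + \<delta>\<close> keeps the pair ordered, because
  \<open>h\<close> is within \<open>\<delta>\<close> of the admissible range. Inserting with error
  \<open>\<delta> / 2\<close> into the narrowed pair moves \<open>h\<close> by at most
  \<open>3 * \<delta> / 2\<close>.\<close>

lemma insertion_refinement:
  assumes X: "normal_space X" and f: "usc_fun X f" and g: "lsc_fun X g"
    and fg: "\<And>x. x \<in> topspace X \<Longrightarrow> a \<le> f x \<and> f x \<le> g x \<and> g x \<le> b"
    and h: "continuous_map X euclideanreal h" and "\<delta> > 0"
    and hb: "\<And>x. x \<in> topspace X \<Longrightarrow> f x - \<delta> \<le> h x \<and> h x \<le> g x + \<delta>"
  shows "\<exists>h'. continuous_map X euclideanreal h' \<and> (\<forall>x\<in>topspace X.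
     f x - \<delta> / 2 \<le> h' x \<and> h' x \<le> g x + \<delta> / 2 \<and> \<bar>h' x - h x\<bar> \<le> 2 * \<delta>)"
proof -
  let ?f = "\<lambda>x. max (f x) (h x - \<delta>)" and ?g = "\<lambda>x. min (g x) (h x + \<delta>)"
  have "continuous_map X euclideanreal (\<lambda>x. h x - \<delta>)"
    "continuous_map X euclideanreal (\<lambda>x. h x + \<delta>)"
    using h by (auto intro!: continuous_intros)
  then have "usc_fun X ?f" "lsc_fun X ?g"
    by (simp_all add: usc_fun_max lsc_fun_min f g continuous_imp_usc_fun continuous_imp_lsc_fun)
  moreover have "a \<le> ?f x \<and> ?f x \<le> ?g x \<and> ?g x \<le> b" if "x \<in> topspace X" for x
    using fg[OF that] hb[OF that] \<open>\<delta> > 0\<close> by (auto simp: max_def min_def)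
  ultimately obtain h' where h': "continuous_map X euclideanreal h'"
    "\<And>x. x \<in> topspace X \<Longrightarrow> ?f x - \<delta> / 2 \<le> h' x \<and> h' x \<le> ?g x + \<delta> / 2"
    using approximate_insertion[OF X, of ?f ?g a b "\<delta> / 2"] \<open>\<delta> > 0\<close> by auto
  have "f x - \<delta> / 2 \<le> h' x \<and> h' x \<le> g x + \<delta> / 2 \<and> \<bar>h' x - h x\<bar> \<le> 2 * \<delta>"
    if "x \<in> topspace X" for x
    using h'(2)[OF that] \<open>\<delta> > 0\<close> by (smt (verit) field_sum_of_halves)
  with h'(1) show ?thesis by blast
qed

text \<open>Refining with errors \<open>(1/2)^n\<close> gives a uniformly Cauchy sequence of
  continuous functions; its limit is continuous and satisfies both inequalities without
  error.\<close>

theorem Katetov_Tong_insertion: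
  assumes X: "normal_space X" and f: "usc_fun X f" and g: "lsc_fun X g"
    and fg: "\<And>x. x \<in> topspace X \<Longrightarrow> a \<le> f x \<and> f x \<le> g x \<and> g x \<le> b"
  shows "\<exists>h. continuous_map X euclideanreal h \<and> (\<forall>x\<in>topspace X. f x \<le> h x \<and> h x \<le> g x)"
proof -
  let ?P = "\<lambda>n h. continuous_map X euclideanreal h \<and>
    (\<forall>x\<in>topspace X. f x - (1/2)^n \<le> h x \<and> h x \<le> g x + (1/2)^n)"
  let ?Q = "\<lambda>n h h'. \<forall>x\<in>topspace X. \<bar>h' x - h x\<bar> \<le> 2 * (1/2::real)^n"
  have "\<exists>h. \<forall>n. ?P n (h n) \<and> ?Q n (h n) (h (Suc n))"
  proof (rule dependent_nat_choice)
    show "\<exists>h. ?P 0 h" using approximate_insertion[OF X f g fg, where \<delta> = 1] by auto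
  next
    fix h n assume "?P n h"
    then have "\<exists>h'. continuous_map X euclideanreal h' \<and> (\<forall>x\<in>topspace X. f x - (1/2)^n / 2 \<le> h' x \<and>
        h' x \<le> g x + (1/2)^n / 2 \<and> \<bar>h' x - h x\<bar> \<le> 2 * (1/2)^n)"
      by (intro insertion_refinement[OF X f g fg]) auto
    then show "\<exists>h'. ?P (Suc n) h' \<and> ?Q n h h'" by auto
  qed
  then obtain h where P: "\<And>n. ?P n (h n)" and Q: "\<And>n. ?Q n (h n) (h (Suc n))" by blast
  \<comment> \<open>The successive differences \<open>2 * (1/2)^i\<close> for \<open>i\<close> from
    \<open>n\<close> to \<open>n + m - 1\<close> telescope to exactly this bound.\<close>
  have step: "\<bar>h (n + m) x - h n x\<bar> \<le> 4 * (1/2)^n - 4 * (1/2)^(n + m)"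
    if x: "x \<in> topspace X" for x n m
  proof (induction m)
    case (Suc m)
    have "\<bar>h (n + Suc m) x - h (n + m) x\<bar> \<le> 2 * (1/2)^(n + m)" using Q x by simp
    moreover have "(4::real) * (1/2)^(n + Suc m) = 2 * (1/2)^(n + m)" by simp
    ultimately show ?case using Suc by linarith
  qed simp
  have step': "\<bar>h (n + m) x - h n x\<bar> \<le> 4 * (1/2)^n" if "x \<in> topspace X" for x n m
  proof -
    have "(0::real) \<le> 4 * (1/2)^(n + m)" by simp
    then show ?thesis using step[OF that, of n m] by linarith
  qed
  have conv: "convergent (\<lambda>n. h n x)" if x: "x \<in> topspace X" for x
    unfolding Cauchy_convergent_iff[symmetric]
  proof (rule metric_CauchyI)
    fix e :: real assume "e > 0"
    then obtain N where N: "(1/2::real)^N < e / 8"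
      using real_arch_pow_inv[of "e/8" "1/2"] by auto
    have near: "dist (h n x) (h N x) \<le> 4 * (1/2)^N" if "n \<ge> N" for n
      using step'[OF x, of N "n - N"] that by (simp add: dist_real_def)
    have "dist (h m x) (h n x) < e" if "n \<ge> N" "m \<ge> N" for m n
      using N near[OF that(1)] near[OF that(2)] dist_triangle2[of "h m x" "h n x" "h N x"]
      by linarith
    then show "\<exists>M. \<forall>m\<ge>M. \<forall>n\<ge>M. dist (h m x) (h n x) < e" by blast
  qed
  define l where "l x = lim (\<lambda>n. h n x)" for x
  have l: "(\<lambda>n. h n x) \<longlonglongrightarrow> l x" if "x \<in> topspace X" for x
    using conv[OF that] unfolding l_def by (simp add: convergent_LIMSEQ_iff)
  have unif: "\<bar>h n x - l x\<bar> \<le> 4 * (1/2)^n" if x: "x \<in> topspace X" for x n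
  proof -
    have "(\<lambda>m. \<bar>h (m + n) x - h n x\<bar>) \<longlonglongrightarrow> \<bar>l x - h n x\<bar>"
      by (intro tendsto_intros LIMSEQ_ignore_initial_segment l x)
    then have "\<bar>l x - h n x\<bar> \<le> 4 * (1/2)^n"
      by (rule LIMSEQ_le_const2) (use step'[OF x, of n] in \<open>auto simp: add.commute\<close>)
    then show ?thesis by linarith
  qed
  have pow0: "(\<lambda>n. (1/2::real)^n) \<longlonglongrightarrow> 0" by (rule LIMSEQ_power_zero) simp
  have "continuous_map X (Met_TC.mtopology) l"
  proof (rule Met_TC.continuous_map_uniform_limit)
    show "\<forall>\<^sub>F n in sequentially. continuous_map X Met_TC.mtopology (h n)"
      using P by simp
    fix e :: real assume "e > 0"
    then have "\<forall>\<^sub>F n in sequentially. (1/2::real)^n < e / 4"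
      using order_tendstoD(2)[OF pow0, of "e/4"] by simp
    then show "\<forall>\<^sub>F n in sequentially. \<forall>x\<in>topspace X. l x \<in> UNIV \<and> dist (h n x) (l x) < e"
    proof (rule eventually_mono)
      fix n assume "(1/2::real)^n < e / 4"
      then have "\<bar>h n x - l x\<bar> < e" if "x \<in> topspace X" for x
        using unif[OF that, of n] by linarith
      then show "\<forall>x\<in>topspace X. l x \<in> UNIV \<and> dist (h n x) (l x) < e"
        by (simp add: dist_real_def)
    qed
  qed simp
  then have "continuous_map X euclideanreal l" by simp
  moreover have "f x \<le> l x \<and> l x \<le> g x" if x: "x \<in> topspace X" for x
  proof
    have "(\<lambda>n. f x - (1/2)^n) \<longlonglongrightarrow> f x - 0" "(\<lambda>n. g x + (1/2)^n) \<longlonglongrightarrow> g x + 0"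
      by (intro tendsto_intros pow0)+
    then show "f x \<le> l x" "l x \<le> g x"
      using LIMSEQ_le[OF _ l[OF x], of "\<lambda>n. f x - (1/2)^n"]
        LIMSEQ_le[OF l[OF x], of "\<lambda>n. g x + (1/2)^n"] P x by auto
  qed
  ultimately show ?thesis by (intro exI[of _ l]) simp
qed

section \<open>Open expansions of closed families\<close>

text \<open>Indices are counted, not sets as in \<open>locally_finite_in\<close>: equal members with
  different indices count separately.\<close>

definition locally_finite_family :: "'a topology \<Rightarrow> ('i \<Rightarrow> 'a set) \<Rightarrow> 'i set \<Rightarrow> bool" where
  "locally_finite_family X F I \<longleftrightarrow>
     (\<forall>x\<in>topspace X. \<exists>V. openin X V \<and> x \<in> V \<and> finite {i\<in>I. F i \<inter> V \<noteq> {}})"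

lemma locally_finite_familyE:
  assumes "x \<in> topspace X" "locally_finite_family X F I"
  obtains V where "openin X V" "x \<in> V" "finite {i\<in>I. F i \<inter> V \<noteq> {}}"
  using assms unfolding locally_finite_family_def by blast

lemma locally_finite_family_subset:
  assumes "locally_finite_family X F I" "\<And>i. i \<in> I \<Longrightarrow> G i \<subseteq> F i" "J \<subseteq> I"
  shows "locally_finite_family X G J"
  unfolding locally_finite_family_def
proof
  fix x assume "x \<in> topspace X"
  then obtain V where V: "openin X V" "x \<in> V" "finite {i\<in>I. F i \<inter> V \<noteq> {}}"
    using assms(1) by (rule locally_finite_familyE)
  have "{i\<in>J. G i \<inter> V \<noteq> {}} \<subseteq> {i\<in>I. F i \<inter> V \<noteq> {}}" using assms(2,3) by blast
  with V show "\<exists>V. openin X V \<and> x \<in> V \<and> finite {i\<in>J. G i \<inter> V \<noteq> {}}"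
    by (meson finite_subset)
qed

lemma closedin_Union_locally_finite_family:
  assumes "locally_finite_family X F I" "\<And>i. i \<in> I \<Longrightarrow> closedin X (F i)"
  shows "closedin X (\<Union>i\<in>I. F i)"
proof (rule closedin_locally_finite_Union)
  show "locally_finite_in X (F ` I)"
    unfolding locally_finite_in_def
  proof safe
    fix x assume "x \<in> topspace X"
    then obtain V where V: "openin X V" "x \<in> V" "finite {i\<in>I. F i \<inter> V \<noteq> {}}"
      using assms(1) by (rule locally_finite_familyE)
    have "{U \<in> F ` I. U \<inter> V \<noteq> {}} = F ` {i\<in>I. F i \<inter> V \<noteq> {}}" by auto
    with V show "\<exists>V. openin X V \<and> x \<in> V \<and> finite {U \<in> F ` I. U \<inter> V \<noteq> {}}"
      by auto
  qed (use assms(2) closedin_subset in blast)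
qed (use assms(2) in auto)

lemma discrete_familyE:
  assumes "x \<in> topspace X" "discrete_family X F I"
  obtains V where "openin X V" "x \<in> V"
    "\<And>i j. \<lbrakk>i \<in> I; j \<in> I; F i \<inter> V \<noteq> {}; F j \<inter> V \<noteq> {}\<rbrakk> \<Longrightarrow> i = j"
  using assms unfolding discrete_family_def by meson

lemma discrete_imp_locally_finite_family:
  assumes "discrete_family X F I" shows "locally_finite_family X F I"
  unfolding locally_finite_family_def
proof
  fix x assume "x \<in> topspace X"
  then obtain V where V: "openin X V" "x \<in> V"
    "\<And>i j. \<lbrakk>i \<in> I; j \<in> I; F i \<inter> V \<noteq> {}; F j \<inter> V \<noteq> {}\<rbrakk> \<Longrightarrow> i = j"
    using assms by (rule discrete_familyE) blast
  have "finite {i\<in>I. F i \<inter> V \<noteq> {}}"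
  proof (cases "{i\<in>I. F i \<inter> V \<noteq> {}} = {}")
    case False
    then obtain j where "j \<in> I" "F j \<inter> V \<noteq> {}" by blast
    then have "{i\<in>I. F i \<inter> V \<noteq> {}} \<subseteq> {j}" using V(3) by blast
    then show ?thesis using finite_subset by blast
  qed (metis finite.emptyI)
  with V show "\<exists>V. openin X V \<and> x \<in> V \<and> finite {i\<in>I. F i \<inter> V \<noteq> {}}" by blast
qed

text \<open>The union of the members that avoid \<open>x\<close> is closed by local finiteness. Its
  complement is a neighbourhood of \<open>x\<close> that meets only members containing
  \<open>x\<close>, and by disjointness there is at most one of these.\<close>

lemma discrete_familyI_disjoint_closed:
  assumes lf: "locally_finite_family X F I" and cl: "\<And>i. i \<in> I \<Longrightarrow> closedin X (F i)"
    and disj: "\<And>i j. \<lbrakk>i \<in> I; j \<in> I; F i \<inter> F j \<noteq> {}\<rbrakk> \<Longrightarrow> i = j"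
  shows "discrete_family X F I"
  unfolding discrete_family_def
proof (intro conjI ballI)
  show "F i \<subseteq> topspace X" if "i \<in> I" for i using cl that closedin_subset by blast
next
  fix x assume x: "x \<in> topspace X"
  define C where "C = (\<Union>i\<in>{i\<in>I. x \<notin> F i}. F i)"
  have "closedin X C"
    unfolding C_def
    by (rule closedin_Union_locally_finite_family)
      (use locally_finite_family_subset[OF lf] cl in auto)
  then have "openin X (topspace X - C)" by blast
  moreover have "x \<in> topspace X - C" using x by (auto simp: C_def)
  moreover have "i = j"
    if "i \<in> I" "j \<in> I" "F i \<inter> (topspace X - C) \<noteq> {}" "F j \<inter> (topspace X - C) \<noteq> {}" for i j
  proof -
    have "x \<in> F i \<inter> F j" using that unfolding C_def by blast
    then show ?thesis using disj that by blast
  qed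
  ultimately show "\<exists>V. openin X V \<and> x \<in> V \<and>
      (\<forall>i\<in>I. \<forall>j\<in>I. F i \<inter> V \<noteq> {} \<and> F j \<inter> V \<noteq> {} \<longrightarrow> i = j)"
    by blast
qed

text \<open>Transfers the definition, where a family of sets indexes itself, to arbitrary index
  sets. Discreteness makes the indexing injective on the nonempty members, so these form a family of
  distinct sets.\<close>

lemma collectionwise_normal_expansion:
  assumes X: "collectionwise_normal \<tau> X" and card: "|I| \<le>o \<tau>"
    and cl: "\<And>i. i \<in> I \<Longrightarrow> closedin X (F i)" and disc: "discrete_family X F I"
  obtains U where "\<And>i. i \<in> I \<Longrightarrow> openin X (U i)" "\<And>i. i \<in> I \<Longrightarrow> F i \<subseteq> U i"
    "discrete_family X U I"
proof -
  define J where "J = {i\<in>I. F i \<noteq> {}}"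
  have inj: "i = j" if "i \<in> J" "j \<in> J" "F i = F j" for i j
  proof -
    obtain x where x: "x \<in> F i" using \<open>i \<in> J\<close> unfolding J_def by blast
    then have "x \<in> topspace X" using cl \<open>i \<in> J\<close> closedin_subset unfolding J_def by blast
    then obtain V where "openin X V" "x \<in> V"
      "\<And>i j. \<lbrakk>i \<in> I; j \<in> I; F i \<inter> V \<noteq> {}; F j \<inter> V \<noteq> {}\<rbrakk> \<Longrightarrow> i = j"
      using disc by (rule discrete_familyE) blast
    then show ?thesis using x that unfolding J_def by blast
  qed
  have "|J| \<le>o |I|" unfolding J_def by (rule card_of_mono1) auto
  then have "|F ` J| \<le>o \<tau>"
    using card by (meson card_of_image ordLeq_transitive)
  moreover have "\<forall>S\<in>F ` J. closedin X S" using cl unfolding J_def by auto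
  moreover have "discrete_family X (\<lambda>S. S) (F ` J)"
    unfolding discrete_family_def
  proof (intro conjI ballI)
    fix x assume "x \<in> topspace X"
    then obtain V where V: "openin X V" "x \<in> V"
      "\<And>i j. \<lbrakk>i \<in> I; j \<in> I; F i \<inter> V \<noteq> {}; F j \<inter> V \<noteq> {}\<rbrakk> \<Longrightarrow> i = j"
      using disc by (rule discrete_familyE) blast
    have "\<forall>S\<in>F ` J. \<forall>T\<in>F ` J. S \<inter> V \<noteq> {} \<and> T \<inter> V \<noteq> {} \<longrightarrow> S = T"
      using V(3) unfolding J_def by blast
    with V(1,2) show "\<exists>V. openin X V \<and> x \<in> V \<and>
        (\<forall>S\<in>F ` J. \<forall>T\<in>F ` J. S \<inter> V \<noteq> {} \<and> T \<inter> V \<noteq> {} \<longrightarrow> S = T)"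
      by blast
  qed (use cl closedin_subset in \<open>auto simp: J_def\<close>)
  ultimately have "\<exists>U. (\<forall>S\<in>F ` J. openin X (U S) \<and> S \<subseteq> U S) \<and> discrete_family X U (F ` J)"
    using X[unfolded collectionwise_normal_def, rule_format, of "F ` J"] by simp
  then obtain U where U: "\<And>S. S \<in> F ` J \<Longrightarrow> openin X (U S) \<and> S \<subseteq> U S"
    and dU: "discrete_family X U (F ` J)"
    by blast
  \<comment> \<open>All empty members coincide as sets; expanding each of them by the empty set
    keeps the expansion discrete as an indexed family.\<close>
  define W where "W i = (if F i = {} then {} else U (F i))" for i
  have W: "openin X (W i)" "F i \<subseteq> W i" if "i \<in> I" for i
    using U[of "F i"] that unfolding W_def J_def by auto
  show thesis
  proof (rule that[OF W])
    show "discrete_family X W I"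
      unfolding discrete_family_def
    proof (intro conjI ballI)
      show "W i \<subseteq> topspace X" if "i \<in> I" for i
        using W(1)[OF that] by (rule openin_subset)
    next
      fix x assume "x \<in> topspace X"
      then obtain V where V: "openin X V" "x \<in> V"
        "\<And>S T. \<lbrakk>S \<in> F ` J; T \<in> F ` J; U S \<inter> V \<noteq> {}; U T \<inter> V \<noteq> {}\<rbrakk> \<Longrightarrow> S = T"
        using dU by (rule discrete_familyE) blast
      have "i = j" if "i \<in> I" "j \<in> I" "W i \<inter> V \<noteq> {}" "W j \<inter> V \<noteq> {}" for i j
      proof -
        have "i \<in> J" "j \<in> J" "U (F i) \<inter> V \<noteq> {}" "U (F j) \<inter> V \<noteq> {}"
          using that unfolding W_def J_def by (auto split: if_splits)
        then show ?thesis using V(3)[of "F i" "F j"] inj by simp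
      qed
      with V(1,2) show "\<exists>V. openin X V \<and> x \<in> V \<and>
          (\<forall>i\<in>I. \<forall>j\<in>I. W i \<inter> V \<noteq> {} \<and> W j \<inter> V \<noteq> {} \<longrightarrow> i = j)"
        by blast
    qed
  qed
qed

text \<open>Two disjoint closed sets form a discrete family indexed by \<open>bool\<close>, and an
  infinite cardinal admits families of two members.\<close>

lemma collectionwise_normal_imp_normal:
  assumes X: "collectionwise_normal \<tau> X" and \<tau>: "Cinfinite \<tau>"
  shows "normal_space X"
  unfolding normal_space_def
proof clarify
  fix S T assume S: "closedin X S" and T: "closedin X T" and ST: "disjnt S T"
  define F where "F b = (if b then S else T)" for b
  have "|UNIV :: bool set| \<le>o |Field \<tau>|"
    using \<tau> by (intro ordLess_imp_ordLeq finite_ordLess_infinite card_of_Well_order)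
      (auto simp: cinfinite_def Field_card_of)
  then have "|UNIV :: bool set| \<le>o \<tau>"
    using \<tau> card_of_Field_ordIso ordLeq_ordIso_trans by blast
  moreover have cl: "closedin X (F b)" for b using S T by (simp add: F_def)
  moreover have "discrete_family X F UNIV"
    using ST cl by (intro discrete_familyI_disjoint_closed)
      (auto simp: F_def locally_finite_family_def disjnt_def split: if_splits)
  ultimately obtain U where U: "\<And>b. openin X (U b)" "\<And>b. F b \<subseteq> U b"
    and disc: "discrete_family X U UNIV"
    using collectionwise_normal_expansion[OF X, of "UNIV :: bool set" F] by auto
  have "disjnt (U True) (U False)"
  proof (rule ccontr)
    assume "\<not> disjnt (U True) (U False)"
    then obtain x where x: "x \<in> U True" "x \<in> U False" by (auto simp: disjnt_iff)
    then have "x \<in> topspace X" using U(1) openin_subset by blast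
    then obtain V where "openin X V" "x \<in> V"
      "\<And>i j. \<lbrakk>i \<in> UNIV; j \<in> UNIV; U i \<inter> V \<noteq> {}; U j \<inter> V \<noteq> {}\<rbrakk> \<Longrightarrow> i = j"
      using disc by (rule discrete_familyE) blast
    then have "True = False" using x by blast
    then show False by simp
  qed
  then show "\<exists>U V. openin X U \<and> openin X V \<and> S \<subseteq> U \<and> T \<subseteq> V \<and> disjnt U V"
    using U by (metis F_def)
qed

text \<open>A set with \<open>n + 1\<close> elements arises from one with \<open>n\<close> elements
  by inserting a point, so each step costs a factor \<open>|I|\<close>, which is absorbed because
  \<open>I\<close> is infinite.\<close>

lemma card_of_subsets_of_card:
  assumes "infinite I"
  shows "|{\<sigma>. \<sigma> \<subseteq> I \<and> finite \<sigma> \<and> card \<sigma> = n}| \<le>o |I|" (is "|?S n| \<le>o _")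
proof (induction n)
  case 0
  have "?S 0 = {{}}" by auto
  moreover have "I \<noteq> {}" using assms by auto
  ultimately show ?case by (simp add: card_of_singl_ordLeq)
next
  case (Suc n)
  have "?S (Suc n) \<subseteq> (\<lambda>(i, \<sigma>). insert i \<sigma>) ` (I \<times> ?S n)"
  proof
    fix \<sigma> assume \<sigma>: "\<sigma> \<in> ?S (Suc n)"
    then obtain i where "i \<in> \<sigma>" by (metis (mono_tags) card.empty ex_in_conv mem_Collect_eq nat.simps(3))
    then have "\<sigma> = insert i (\<sigma> - {i})" "\<sigma> - {i} \<in> ?S n" "i \<in> I" using \<sigma> by auto
    then show "\<sigma> \<in> (\<lambda>(i, \<sigma>). insert i \<sigma>) ` (I \<times> ?S n)" by (metis (no_types, lifting) SigmaI case_prod_conv image_eqI)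
  qed
  then have "|?S (Suc n)| \<le>o |I \<times> ?S n|" by (rule surj_imp_ordLeq)
  also have "|I \<times> ?S n| \<le>o |I \<times> I|" using Suc by (rule card_of_Times_mono2)
  also have "|I \<times> I| =o |I|" using assms by (rule card_of_Times_same_infinite)
  finally show ?case .
qed

text \<open>Induction on the order \<open>k\<close>: the intersections of \<open>k + 1\<close> members form a discrete family;
  removing an open expansion of it lowers the order.\<close>

lemma bounded_order_expansion:
  assumes X: "collectionwise_normal \<tau> X" and "infinite I" and card: "|I| \<le>o \<tau>"
    and cl: "\<And>i. i \<in> I \<Longrightarrow> closedin X (F i)" and lf: "locally_finite_family X F I"
    and order: "\<And>x. x \<in> topspace X \<Longrightarrow> card {i\<in>I. x \<in> F i} \<le> k"
  shows "\<exists>U. (\<forall>i\<in>I. openin X (U i) \<and> F i \<subseteq> U i) \<and> locally_finite_family X U I"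
  using cl lf order
proof (induction k arbitrary: F)
  case 0
  have "F i = {}" if "i \<in> I" for i
  proof (rule ccontr)
    assume "F i \<noteq> {}"
    then obtain x where x: "x \<in> F i" by blast
    then have "x \<in> topspace X" using 0(1) that closedin_subset by blast
    then obtain V where "openin X V" "x \<in> V" "finite {i\<in>I. F i \<inter> V \<noteq> {}}"
      using 0(2) by (rule locally_finite_familyE)
    \<comment> \<open>An infinite index set would also have \<open>card\<close> 0, so finiteness is
      established before the order bound 0 is used.\<close>
    then have "finite {i\<in>I. x \<in> F i}" by (auto elim!: rev_finite_subset)
    then show False using 0(3)[OF \<open>x \<in> topspace X\<close>] x that by auto
  qed
  then show ?case using 0(2) by (intro exI[of _ F]) auto
next
  case (Suc k)
  define S where "S = {\<sigma>. \<sigma> \<subseteq> I \<and> finite \<sigma> \<and> card \<sigma> = Suc k}"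
  define G where "G \<sigma> = (\<Inter>i\<in>\<sigma>. F i)" for \<sigma>
  have "|S| \<le>o \<tau>"
    unfolding S_def by (rule ordLeq_transitive[OF card_of_subsets_of_card[OF \<open>infinite I\<close>] card])
  moreover have clG: "closedin X (G \<sigma>)" if "\<sigma> \<in> S" for \<sigma>
    unfolding G_def using that Suc(2) by (intro closedin_INT) (auto simp: S_def)
  moreover have "discrete_family X G S"
  proof (rule discrete_familyI_disjoint_closed[OF _ clG])
    show "locally_finite_family X G S"
      unfolding locally_finite_family_def
    proof
      fix x assume "x \<in> topspace X"
      then obtain V where V: "openin X V" "x \<in> V" "finite {i\<in>I. F i \<inter> V \<noteq> {}}"
        using Suc(3) by (rule locally_finite_familyE)
      have "{\<sigma>\<in>S. G \<sigma> \<inter> V \<noteq> {}} \<subseteq> Pow {i\<in>I. F i \<inter> V \<noteq> {}}"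
        unfolding S_def G_def by blast
      with V show "\<exists>V. openin X V \<and> x \<in> V \<and> finite {\<sigma>\<in>S. G \<sigma> \<inter> V \<noteq> {}}"
        by (meson finite_Pow_iff finite_subset)
    qed
  next
    fix \<sigma> \<rho> assume \<sigma>: "\<sigma> \<in> S" and \<rho>: "\<rho> \<in> S" and "G \<sigma> \<inter> G \<rho> \<noteq> {}"
    then obtain x where x: "x \<in> G \<sigma>" "x \<in> G \<rho>" by blast
    then have xX: "x \<in> topspace X" using clG[OF \<sigma>] closedin_subset by blast
    then obtain V where "openin X V" "x \<in> V" "finite {i\<in>I. F i \<inter> V \<noteq> {}}"
      using Suc(3) by (rule locally_finite_familyE)
    then have fin: "finite {i\<in>I. x \<in> F i}" by (auto elim!: rev_finite_subset)
    \<comment> \<open>The indices of members containing \<open>x\<close> number at most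
      \<open>Suc k\<close>, so a subset with \<open>Suc k\<close> elements must exhaust
      them.\<close>
    have "\<sigma> = {i\<in>I. x \<in> F i}" if "\<sigma> \<in> S" "x \<in> G \<sigma>" for \<sigma>
      using that Suc(4)[OF xX] by (intro card_seteq[OF fin]) (auto simp: S_def G_def)
    then show "\<sigma> = \<rho>" using \<sigma> \<rho> x by metis
  qed
  ultimately obtain W where W: "\<And>\<sigma>. \<sigma> \<in> S \<Longrightarrow> openin X (W \<sigma>)" "\<And>\<sigma>. \<sigma> \<in> S \<Longrightarrow> G \<sigma> \<subseteq> W \<sigma>"
    and disc: "discrete_family X W S"
    using collectionwise_normal_expansion[OF X] by metis
  define F' where "F' i = F i - (\<Union>\<sigma>\<in>{\<sigma>\<in>S. i \<in> \<sigma>}. W \<sigma>)" for i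
  have "\<exists>U. (\<forall>i\<in>I. openin X (U i) \<and> F' i \<subseteq> U i) \<and> locally_finite_family X U I"
  proof (rule Suc.IH)
    show "closedin X (F' i)" if "i \<in> I" for i
      unfolding F'_def using Suc(2) that W(1) by (intro closedin_diff openin_Union) auto
    show "locally_finite_family X F' I"
      by (rule locally_finite_family_subset[OF Suc(3)]) (auto simp: F'_def)
    fix x assume x: "x \<in> topspace X"
    show "card {i\<in>I. x \<in> F' i} \<le> k"
    proof (rule ccontr)
      assume "\<not> card {i\<in>I. x \<in> F' i} \<le> k"
      then obtain \<sigma> where \<sigma>: "\<sigma> \<subseteq> {i\<in>I. x \<in> F' i}" "card \<sigma> = Suc k" "finite \<sigma>"
        using obtain_subset_with_card_n[of "Suc k" "{i\<in>I. x \<in> F' i}"] by force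
      then have "\<sigma> \<in> S" "x \<in> G \<sigma>" "\<sigma> \<noteq> {}" by (auto simp: S_def G_def F'_def)
      then show False using W(2) \<sigma>(1) unfolding F'_def by blast
    qed
  qed
  then obtain U where U: "\<And>i. i \<in> I \<Longrightarrow> openin X (U i) \<and> F' i \<subseteq> U i"
    and lfU: "locally_finite_family X U I"
    by blast
  \<comment> \<open>The points of \<open>F i\<close> removed in \<open>F' i\<close> lie in sets
    \<open>W \<sigma>\<close> with \<open>i \<in> \<sigma>\<close>; these are put back.\<close>
  define O' where "O' i = U i \<union> (\<Union>\<sigma>\<in>{\<sigma>\<in>S. i \<in> \<sigma>}. W \<sigma>)" for i
  have "openin X (O' i) \<and> F i \<subseteq> O' i" if "i \<in> I" for i
  proof
    show "openin X (O' i)"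
      unfolding O'_def using U[OF that] W(1) by (intro openin_Un openin_Union) auto
    show "F i \<subseteq> O' i"
      using U[OF that] unfolding O'_def F'_def by blast
  qed
  moreover have "locally_finite_family X O' I"
    unfolding locally_finite_family_def
  proof
    fix x assume x: "x \<in> topspace X"
    obtain V where V: "openin X V" "x \<in> V" "finite {i\<in>I. U i \<inter> V \<noteq> {}}"
      using x lfU by (rule locally_finite_familyE)
    obtain V' where V': "openin X V'" "x \<in> V'" "finite {\<sigma>\<in>S. W \<sigma> \<inter> V' \<noteq> {}}"
      using x discrete_imp_locally_finite_family[OF disc] by (rule locally_finite_familyE)
    \<comment> \<open>Only finitely many \<open>W \<sigma>\<close> meet \<open>V'\<close>, and each
      such \<open>\<sigma>\<close> is a finite set of indices.\<close>
    have "{i\<in>I. O' i \<inter> (V \<inter> V') \<noteq> {}} \<subseteq>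
        {i\<in>I. U i \<inter> V \<noteq> {}} \<union> \<Union>{\<sigma>\<in>S. W \<sigma> \<inter> V' \<noteq> {}}"
      unfolding O'_def by blast
    moreover have "finite (\<Union>{\<sigma>\<in>S. W \<sigma> \<inter> V' \<noteq> {}})"
      using V'(3) by (rule finite_Union) (simp add: S_def)
    ultimately have "finite {i\<in>I. O' i \<inter> (V \<inter> V') \<noteq> {}}"
      using V(3) by (meson finite_UnI finite_subset)
    with V V' show "\<exists>V. openin X V \<and> x \<in> V \<and> finite {i\<in>I. O' i \<inter> V \<noteq> {}}"
      by (intro exI[of _ "V \<inter> V'"]) (simp add: openin_Int)
  qed
  ultimately show ?case by blast
qed

section \<open>Geometry of the hedgehog\<close>

text \<open>The parameter \<open>B\<close> lets one function serve as the distance to the origin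
  (\<open>UNIV\<close>), as the height along one spine (a singleton) and as the height off given
  spines (a complement).\<close>

definition height :: "'c set \<Rightarrow> 'c hedgehog \<Rightarrow> real" where
  "height B p = (case p of Origin \<Rightarrow> 0 | Spine s \<alpha> \<Rightarrow> if \<alpha> \<in> B then s else 0)"

lemma height_simps [simp]:
  "height B Origin = 0" "height B (Spine s \<alpha>) = (if \<alpha> \<in> B then s else 0)"
  by (simp_all add: height_def)

text \<open>On the hedgehog this combination is the distance to the origin with a sign depending on
  the spine; it inherits continuity from \<open>height\<close>.\<close>

definition level :: "'c \<Rightarrow> 'c hedgehog \<Rightarrow> real" where
  "level \<beta> p = 2 * height {\<beta>} p - height UNIV p"

lemma level_simps [simp]:
  "level \<beta> Origin = 0" "level \<beta> (Spine s \<alpha>) = (if \<alpha> = \<beta> then s else - s)"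
  by (simp_all add: level_def)

lemma Origin_in_hedgehog_points [simp]: "Origin \<in> hedgehog_points A"
  by (simp add: hedgehog_points_def)

lemma Spine_in_hedgehog_points [simp]:
  "Spine s \<alpha> \<in> hedgehog_points A \<longleftrightarrow> 0 < s \<and> s \<le> 1 \<and> \<alpha> \<in> A"
  by (auto simp: hedgehog_points_def)

lemma height_bounds:
  assumes "p \<in> hedgehog_points A" shows "0 \<le> height B p" "height B p \<le> 1"
  using assms by (cases p; simp)+

lemma level_bounds:
  assumes "p \<in> hedgehog_points A" shows "-1 \<le> level \<beta> p" "level \<beta> p \<le> 1"
  using assms by (cases p; simp)+

lemma height_Lipschitz:
  assumes "p \<in> hedgehog_points A" "q \<in> hedgehog_points A"
  shows "\<bar>height B p - height B q\<bar> \<le> hedgehog_dist p q"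
  using assms by (cases p; cases q) auto

lemma continuous_map_height [continuous_intros]:
  "continuous_map (hedgehog A) euclideanreal (height B)"
proof -
  interpret Metric_space "hedgehog_points A" hedgehog_dist by (rule Metric_space_hedgehog)
  have "continuous_map mtopology Met_TC.mtopology (height B)"
    unfolding metric_continuous_map[OF Met_TC.Metric_space_axioms]
  proof (intro conjI ballI allI impI)
    fix p and e :: real assume p: "p \<in> hedgehog_points A" and "e > 0"
    have "dist (height B p) (height B q) < e" if "q \<in> hedgehog_points A" "hedgehog_dist p q < e" for q
      using height_Lipschitz[OF p that(1), of B] that(2) by (simp add: dist_real_def)
    with \<open>e > 0\<close>
    show "\<exists>\<delta>>0. \<forall>q. q \<in> hedgehog_points A \<and> hedgehog_dist p q < \<delta> \<longrightarrow> dist (height B p) (height B q) < e"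
      by blast
  qed auto
  then show ?thesis by (simp add: hedgehog_def)
qed

lemma continuous_map_level [continuous_intros]:
  "continuous_map (hedgehog A) euclideanreal (level \<beta>)"
  unfolding level_def by (intro continuous_intros)

lemma closedin_height_ge: "closedin (hedgehog A) {p \<in> hedgehog_points A. c \<le> height B p}"
  using continuous_map_height[of A B] unfolding continuous_map_upper_lower_semicontinuous_le
  by simp

lemma closedin_height_le: "closedin (hedgehog A) {p \<in> hedgehog_points A. height B p \<le> c}"
  using continuous_map_height[of A B] unfolding continuous_map_upper_lower_semicontinuous_le
  by simp

lemma openin_height_gt: "openin (hedgehog A) {p \<in> hedgehog_points A. c < height B p}"
  using continuous_map_height[of A B] unfolding continuous_map_upper_lower_semicontinuous_lt
  by simp

section \<open>Arcs along the spines\<close>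

definition spine_arc :: "'c \<Rightarrow> real \<Rightarrow> 'c hedgehog" where
  "spine_arc \<alpha> s = (if s \<le> 0 then Origin else Spine s \<alpha>)"

lemma continuous_map_spine_arc:
  assumes "\<alpha> \<in> A"
  shows "continuous_map (top_of_set {..1}) (hedgehog A) (spine_arc \<alpha>)"
proof -
  interpret Metric_space "hedgehog_points A" hedgehog_dist by (rule Metric_space_hedgehog)
  \<comment> \<open>The constant continuation by \<open>Origin\<close> for nonpositive parameters
    keeps the arc 1-Lipschitz, so intervals around small parameters need no trimming at 0.\<close>
  have d: "hedgehog_dist (spine_arc \<alpha> s) (spine_arc \<alpha> t) \<le> \<bar>s - t\<bar>" for s t
    by (auto simp: spine_arc_def)
  have "continuous_map (top_of_set {..1}) mtopology (spine_arc \<alpha>)"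
    unfolding continuous_map_to_metric
  proof (intro ballI allI impI)
    fix s e :: real assume s: "s \<in> topspace (top_of_set {..1})" and "e > 0"
    let ?U = "{..1} \<inter> ball s e"
    have "openin (top_of_set {..1}) ?U" by (simp add: openin_open_Int)
    moreover have "\<forall>t\<in>?U. spine_arc \<alpha> t \<in> mball (spine_arc \<alpha> s) e"
      using s d[of s] assms by (fastforce simp: in_mball dist_real_def spine_arc_def)
    ultimately show "\<exists>U. openin (top_of_set {..1}) U \<and> s \<in> U \<and> (\<forall>t\<in>U. spine_arc \<alpha> t \<in> mball (spine_arc \<alpha> s) e)"
      using s \<open>e > 0\<close> by (intro exI[of _ ?U]) simp
  qed
  then show ?thesis by (simp add: hedgehog_def)
qed

lemma compactin_spine_arc:
  assumes "\<alpha> \<in> A" "b \<le> 1" shows "compactin (hedgehog A) (spine_arc \<alpha> ` {a..b})"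
  by (rule image_compactin[OF _ continuous_map_spine_arc[OF assms(1)]])
    (use assms(2) in \<open>auto simp: compactin_subtopology\<close>)

lemma connectedin_spine_arc:
  assumes "\<alpha> \<in> A" "b \<le> 1" shows "connectedin (hedgehog A) (spine_arc \<alpha> ` {a..b})"
  by (rule connectedin_continuous_map_image[OF continuous_map_spine_arc[OF assms(1)]])
    (use assms(2) in \<open>auto simp: connectedin_subtopology\<close>)

section \<open>Neighbourhoods and compact sets in the hedgehog\<close>

lemma openin_hedgehog_Origin:
  assumes "openin (hedgehog A) U" "Origin \<in> U"
  obtains e where "e > 0" "\<And>p. \<lbrakk>p \<in> hedgehog_points A; height UNIV p < e\<rbrakk> \<Longrightarrow> p \<in> U"
proof -
  interpret Metric_space "hedgehog_points A" hedgehog_dist by (rule Metric_space_hedgehog)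
  obtain e where e: "e > 0" "mball Origin e \<subseteq> U"
    using assms unfolding hedgehog_def openin_mtopology by blast
  have "p \<in> U" if p: "p \<in> hedgehog_points A" "height UNIV p < e" for p
  proof -
    have "hedgehog_dist Origin p < e" using p by (cases p) auto
    then show ?thesis using p e(2) by auto
  qed
  with e(1) that show thesis by blast
qed

lemma openin_hedgehog_Spine:
  assumes U: "openin (hedgehog A) U" "Spine s \<alpha> \<in> U"
  obtains e where "e > 0" "\<And>t. \<lbrakk>t \<le> 1; \<bar>t - s\<bar> < e\<rbrakk> \<Longrightarrow> spine_arc \<alpha> t \<in> U"
proof -
  have p: "0 < s" "s \<le> 1" "\<alpha> \<in> A" using openin_subset[OF U(1)] U(2) by auto
  have "openin (top_of_set {..1}) {t \<in> topspace (top_of_set {..1}). spine_arc \<alpha> t \<in> U}"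
    using continuous_map_spine_arc[OF p(3)] U(1) by (rule openin_continuous_map_preimage)
  moreover have "s \<in> {t \<in> topspace (top_of_set {..1}). spine_arc \<alpha> t \<in> U}"
    using p U(2) by (simp add: spine_arc_def)
  ultimately obtain e where "e > 0" "ball s e \<inter> {..1} \<subseteq> {t \<in> topspace (top_of_set {..1}). spine_arc \<alpha> t \<in> U}"
    unfolding openin_contains_ball by blast
  then show thesis by (intro that[of e]) (auto simp: dist_real_def subset_iff)
qed

text \<open>A neighbourhood of \<open>Origin\<close> contains all points of height below some
  \<open>e\<close>; the rest of \<open>C\<close> lies on finitely many compact arcs.\<close>

lemma compactin_hedgehog:
  assumes C: "closedin (hedgehog A) C"
    and fin: "\<And>e. e > 0 \<Longrightarrow> finite {\<alpha>. \<exists>s\<ge>e. Spine s \<alpha> \<in> C}"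
  shows "compactin (hedgehog A) C"
proof (rule closed_compactin[OF _ _ C])
  have CA: "C \<subseteq> hedgehog_points A" using closedin_subset[OF C] by simp
  \<comment> \<open>Adjoining \<open>Origin\<close> guarantees that some member of the cover
    contains it; \<open>C\<close> is then a closed subset of a compact set.\<close>
  show "compactin (hedgehog A) (insert Origin C)"
    unfolding compactin_def
  proof (intro conjI allI impI)
    show "insert Origin C \<subseteq> topspace (hedgehog A)" using CA by simp
    fix \<U> assume \<U>: "(\<forall>U\<in>\<U>. openin (hedgehog A) U) \<and> insert Origin C \<subseteq> \<Union>\<U>"
    then obtain U where U: "U \<in> \<U>" "Origin \<in> U" "openin (hedgehog A) U" by auto
    obtain e where e: "e > 0" "\<And>p. \<lbrakk>p \<in> hedgehog_points A; height UNIV p < e\<rbrakk> \<Longrightarrow> p \<in> U"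
      using openin_hedgehog_Origin[OF U(3,2)] by blast
    define B where "B = {\<alpha>. \<exists>s\<ge>e. Spine s \<alpha> \<in> C}"
    have "B \<subseteq> A" using CA unfolding B_def by auto
    then have "compactin (hedgehog A) (\<Union>\<alpha>\<in>B. spine_arc \<alpha> ` {0..1})"
      using fin[OF e(1)] unfolding B_def[symmetric]
      by (intro compactin_Union) (auto intro: compactin_spine_arc)
    then have "compactin (hedgehog A) (C \<inter> (\<Union>\<alpha>\<in>B. spine_arc \<alpha> ` {0..1}))" (is "compactin _ ?K")
      by (rule closed_Int_compactin[OF C])
    moreover have "?K \<subseteq> \<Union>\<U>" using \<U> by blast
    ultimately obtain \<F> where \<F>: "finite \<F>" "\<F> \<subseteq> \<U>" "?K \<subseteq> \<Union>\<F>"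
      using \<U> unfolding compactin_def by meson
    have "C \<subseteq> U \<union> ?K"
    proof
      fix p assume p: "p \<in> C"
      show "p \<in> U \<union> ?K"
      proof (cases "height UNIV p < e")
        case False
        then obtain s \<alpha> where s: "p = Spine s \<alpha>" "s \<ge> e" using e(1) by (cases p) auto
        moreover have "0 \<le> s" "s \<le> 1" using s p CA by auto
        ultimately have "p = spine_arc \<alpha> s" "\<alpha> \<in> B"
          using e(1) p unfolding spine_arc_def B_def by auto
        moreover have "s \<in> {0..1}" using \<open>0 \<le> s\<close> \<open>s \<le> 1\<close> by simp
        ultimately show ?thesis using p by blast
      qed (use e(2) p CA in auto)
    qed
    then have "insert Origin C \<subseteq> \<Union>(insert U \<F>)" using \<F>(3) U(2) by auto
    then show "\<exists>\<F>. finite \<F> \<and> \<F> \<subseteq> \<U> \<and> insert Origin C \<subseteq> \<Union>\<F>"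
      using \<F> U(1) by (intro exI[of _ "insert U \<F>"]) auto
  qed
qed auto

section \<open>Subtrees with prescribed levels\<close>

text \<open>The minimum of \<open>0\<close> and the second largest of the numbers \<open>h \<alpha>\<close>: a connected set that reaches
  the level \<open>h \<alpha>\<close> for each \<open>\<alpha>\<close> comes at least as close to the origin as the negative of this.\<close>

definition second_level :: "'c set \<Rightarrow> ('c \<Rightarrow> real) \<Rightarrow> real" where
  "second_level A h = (SUP (\<gamma>, \<delta>)\<in>{(\<gamma>, \<delta>). \<gamma> \<in> A \<and> \<delta> \<in> A \<and> \<gamma> \<noteq> \<delta>}. min (min (h \<gamma>) (h \<delta>)) 0)"

text \<open>Two shapes occur. If the second level is nonnegative, the set is a union of arcs
  starting at \<open>Origin\<close>. If it is negative, at most one spine has nonnegative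
  \<open>h\<close>, and the set is empty or a segment of that spine starting at height
  \<open>- second_level A h\<close>.\<close>

definition subtree :: "'c set \<Rightarrow> ('c \<Rightarrow> real) \<Rightarrow> 'c hedgehog set" where
  "subtree A h = {p \<in> hedgehog_points A. - second_level A h \<le> height UNIV p \<and>
     (\<forall>s \<alpha>. p = Spine s \<alpha> \<longrightarrow> s \<le> h \<alpha>)}"

lemma Origin_in_subtree: "Origin \<in> subtree A h \<longleftrightarrow> 0 \<le> second_level A h"
  by (simp add: subtree_def)

lemma Spine_in_subtree:
  "Spine s \<alpha> \<in> subtree A h \<longleftrightarrow> 0 < s \<and> s \<le> 1 \<and> \<alpha> \<in> A \<and> - second_level A h \<le> s \<and> s \<le> h \<alpha>"
  by (auto simp: subtree_def)

lemma infinite_obtain_other: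
  assumes "infinite A" obtains \<beta> where "\<beta> \<in> A" "\<beta> \<noteq> \<alpha>"
  using assms by (metis finite.simps infinite_remove Diff_iff ex_in_conv insertI1)

lemma second_level_ge:
  assumes "\<gamma> \<in> A" "\<delta> \<in> A" "\<gamma> \<noteq> \<delta>" shows "min (min (h \<gamma>) (h \<delta>)) 0 \<le> second_level A h"
proof -
  have "bdd_above ((\<lambda>(\<gamma>, \<delta>). min (min (h \<gamma>) (h \<delta>)) 0) ` {(\<gamma>, \<delta>). \<gamma> \<in> A \<and> \<delta> \<in> A \<and> \<gamma> \<noteq> \<delta>})"
    by (rule bdd_aboveI[of _ 0]) auto
  then show ?thesis
    unfolding second_level_def using assms by (intro cSUP_upper2[where x = "(\<gamma>, \<delta>)"]) auto
qed

lemma second_level_le: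
  assumes "infinite A"
    and "\<And>\<gamma> \<delta>. \<lbrakk>\<gamma> \<in> A; \<delta> \<in> A; \<gamma> \<noteq> \<delta>\<rbrakk> \<Longrightarrow> min (min (h \<gamma>) (h \<delta>)) 0 \<le> b"
  shows "second_level A h \<le> b"
proof -
  obtain \<gamma> where "\<gamma> \<in> A" using assms(1) by (metis finite.emptyI ex_in_conv)
  moreover obtain \<delta> where "\<delta> \<in> A" "\<delta> \<noteq> \<gamma>" using infinite_obtain_other[OF assms(1)] .
  ultimately have "(\<gamma>, \<delta>) \<in> {(\<gamma>, \<delta>). \<gamma> \<in> A \<and> \<delta> \<in> A \<and> \<gamma> \<noteq> \<delta>}" by simp
  then show ?thesis
    unfolding second_level_def using assms(2) by (intro cSUP_least) auto
qed

text \<open>Two different spines with nonnegative \<open>h\<close> would contribute the value 0 to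
  the supremum.\<close>

lemma second_level_unique:
  assumes "second_level A h < 0" "\<alpha> \<in> A" "\<beta> \<in> A" "0 \<le> h \<alpha>" "0 \<le> h \<beta>"
  shows "\<alpha> = \<beta>"
  using second_level_ge[of \<alpha> A \<beta> h] assms by fastforce

text \<open>For \<open>p = Spine s \<alpha>\<close> the level along every other spine is
  \<open>- s\<close>. Pairing \<open>\<alpha>\<close> with one such spine bounds the second level
  from below by \<open>- s\<close>.\<close>

lemma subset_subtree:
  assumes A: "infinite A" and p: "p \<in> hedgehog_points A" and h: "\<And>\<beta>. \<beta> \<in> A \<Longrightarrow> level \<beta> p \<le> h \<beta>"
  shows "p \<in> subtree A h"
proof (cases p)
  case Origin
  obtain \<gamma> where "\<gamma> \<in> A" using A by (metis finite.emptyI ex_in_conv)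
  moreover obtain \<delta> where "\<delta> \<in> A" "\<delta> \<noteq> \<gamma>" using infinite_obtain_other[OF A] .
  ultimately show ?thesis
    using second_level_ge[of \<gamma> A \<delta> h] h[of \<gamma>] h[of \<delta>] Origin by (simp add: Origin_in_subtree)
next
  case (Spine s \<alpha>)
  then have s: "0 < s" "s \<le> 1" "\<alpha> \<in> A" using p by auto
  obtain \<delta> where \<delta>: "\<delta> \<in> A" "\<delta> \<noteq> \<alpha>" using infinite_obtain_other[OF A] .
  have "s \<le> h \<alpha>" "- s \<le> h \<delta>" using h[OF s(3)] h[OF \<delta>(1)] \<delta> Spine by auto
  then show ?thesis
    using second_level_ge[OF s(3) \<delta>(1), of h] \<delta>(2) s Spine by (auto simp: Spine_in_subtree)
qed

text \<open>If \<open>S\<close> lies on the spine \<open>\<alpha>\<close> beyond height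
  \<open>s\<close>, compactness provides a lowest point \<open>q\<close> of \<open>S\<close>. Every
  other spine then has \<open>h \<beta> \<le> - level \<alpha> q\<close>, and each pair of distinct
  spines contains such a \<open>\<beta>\<close>. Since \<open>q\<close> is attained, the inequality
  is strict.\<close>

lemma second_level_less:
  assumes A: "infinite A" and S: "compactin (hedgehog A) S"
    and h: "\<And>\<beta>. \<beta> \<in> A \<Longrightarrow> \<exists>p\<in>S. h \<beta> \<le> level \<beta> p"
    and s: "0 \<le> s" "\<And>p. p \<in> S \<Longrightarrow> s < level \<alpha> p"
  shows "second_level A h < - s"
proof -
  have "compact (level \<alpha> ` S)"
    using image_compactin[OF S continuous_map_level[of A \<alpha>]] by simp
  moreover obtain \<beta> where "\<beta> \<in> A" using A by (metis finite.emptyI ex_in_conv)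
  then have "level \<alpha> ` S \<noteq> {}" using h by blast
  ultimately obtain q where q: "q \<in> S" "\<And>p. p \<in> S \<Longrightarrow> level \<alpha> q \<le> level \<alpha> p"
    using compact_attains_inf[of "level \<alpha> ` S"] by auto
  have le: "h \<beta> \<le> - level \<alpha> q" if "\<beta> \<in> A" "\<beta> \<noteq> \<alpha>" for \<beta>
  proof -
    obtain p where p: "p \<in> S" "h \<beta> \<le> level \<beta> p" using h \<open>\<beta> \<in> A\<close> by blast
    have "p \<in> hedgehog_points A" using p(1) compactin_subset_topspace[OF S] by auto
    then have "level \<beta> p \<le> - level \<alpha> p"
      using s(1) s(2)[OF p(1)] that(2) by (cases p) (auto split: if_splits)
    then show ?thesis using p q(2)[OF p(1)] by linarith
  qed
  have "second_level A h \<le> - level \<alpha> q"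
  proof (rule second_level_le[OF A])
    fix \<gamma> \<delta> assume "\<gamma> \<in> A" "\<delta> \<in> A" "\<gamma> \<noteq> \<delta>"
    then show "min (min (h \<gamma>) (h \<delta>)) 0 \<le> - level \<alpha> q"
      using le[of \<gamma>] le[of \<delta>] by (cases "\<gamma> = \<alpha>") auto
  qed
  then show ?thesis using s(2)[OF q(1)] by linarith
qed

lemma level_image_interval:
  assumes "connectedin (hedgehog A) S" "p \<in> S" "q \<in> S" "level \<alpha> q \<le> s" "s \<le> level \<alpha> p"
  obtains u where "u \<in> S" "level \<alpha> u = s"
proof -
  have "connected (level \<alpha> ` S)"
    using connectedin_continuous_map_image[OF continuous_map_level assms(1)] by simp
  then have "s \<in> level \<alpha> ` S"
    using assms by (meson connectedD_interval image_eqI)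
  with that show thesis by blast
qed

text \<open>For a point of height \<open>s\<close> on the spine \<open>\<alpha>\<close>, the set
  \<open>S\<close> has a point of level at least \<open>s\<close>, while
  \<open>second_level_less\<close> prevents \<open>S\<close> from lying entirely above
  \<open>s\<close>. By connectedness the level \<open>s\<close> is attained, and a nonnegative level
  along \<open>\<alpha>\<close> determines the point.\<close>

lemma subtree_subset:
  assumes A: "infinite A" and S: "compactin (hedgehog A) S" "connectedin (hedgehog A) S"
    and h: "\<And>\<beta>. \<beta> \<in> A \<Longrightarrow> \<exists>p\<in>S. h \<beta> \<le> level \<beta> p"
  shows "subtree A h \<subseteq> S"
proof
  fix p assume p: "p \<in> subtree A h"
  have SA: "S \<subseteq> hedgehog_points A" using compactin_subset_topspace[OF S(1)] by simp
  show "p \<in> S"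
  proof (cases p)
    case Origin
    then have 0: "0 \<le> second_level A h" using p by (simp add: Origin_in_subtree)
    obtain \<beta> where "\<beta> \<in> A" using A by (metis finite.emptyI ex_in_conv)
    then obtain q where q: "q \<in> S" using h by blast
    show ?thesis
    proof (cases q)
      case (Spine t \<alpha>)
      then have t: "0 < t" using q SA by auto
      have "\<not> (\<forall>u\<in>S. 0 < level \<alpha> u)" using second_level_less[OF A S(1) h, of 0 \<alpha>] 0 by fastforce
      then obtain u where "u \<in> S" "level \<alpha> u \<le> 0" by force
      then obtain v where v: "v \<in> S" "level \<alpha> v = 0"
        using level_image_interval[OF S(2) q, of u \<alpha> 0] Spine t by auto
      moreover have "v \<in> hedgehog_points A" using v(1) SA by blast
      ultimately have "v = Origin" by (cases v) (auto split: if_splits)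
      then show ?thesis using v Origin by simp
    qed (use q Origin in simp)
  next
    case (Spine s \<alpha>)
    then have s: "0 < s" "\<alpha> \<in> A" "- second_level A h \<le> s" "s \<le> h \<alpha>"
      using p by (simp_all add: Spine_in_subtree)
    obtain q where q: "q \<in> S" "h \<alpha> \<le> level \<alpha> q" using h[OF s(2)] by blast
    have "\<not> (\<forall>u\<in>S. s < level \<alpha> u)" using second_level_less[OF A S(1) h, of s \<alpha>] s by fastforce
    then obtain u where "u \<in> S" "level \<alpha> u \<le> s" by force
    then obtain v where v: "v \<in> S" "level \<alpha> v = s"
      using level_image_interval[OF S(2) q(1), of u \<alpha> s] q(2) s(4) by auto
    moreover have "v \<in> hedgehog_points A" using v(1) SA by blast
    ultimately have "v = Spine s \<alpha>" using s(1) by (cases v) (auto split: if_splits)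
    then show ?thesis using v Spine by simp
  qed
qed

lemma closedin_subtree: "closedin (hedgehog A) (subtree A h)"
proof -
  \<comment> \<open>Off the spine \<open>\<alpha>\<close> the function
    \<open>height {\<alpha>}\<close> vanishes, so a negative \<open>h \<alpha>\<close> must not
    exclude these points; on the spine, positivity of \<open>s\<close> makes \<open>max 0\<close>
    harmless.\<close>
  have "subtree A h = {p \<in> hedgehog_points A. - second_level A h \<le> height UNIV p} \<inter>
      (\<Inter>\<alpha>. {p \<in> hedgehog_points A. height {\<alpha>} p \<le> max 0 (h \<alpha>)})" (is "_ = ?R")
  proof (intro set_eqI iffI)
    fix p assume "p \<in> subtree A h"
    then show "p \<in> ?R" by (cases p) (auto simp: subtree_def)
  next
    fix p assume p: "p \<in> ?R"
    then show "p \<in> subtree A h"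
    proof (cases p)
      case (Spine s \<alpha>)
      then have "height {\<alpha>} p \<le> max 0 (h \<alpha>)" using p by blast
      then show ?thesis using p Spine by (auto simp: subtree_def)
    qed (auto simp: subtree_def)
  qed
  then show ?thesis by (auto intro!: closedin_Int closedin_INT closedin_height_ge closedin_height_le)
qed

lemma compactin_subtree:
  assumes "\<And>e. e > 0 \<Longrightarrow> finite {\<beta>\<in>A. e \<le> h \<beta>}"
  shows "compactin (hedgehog A) (subtree A h)"
proof (rule compactin_hedgehog[OF closedin_subtree])
  fix e :: real assume "e > 0"
  have "{\<alpha>. \<exists>s\<ge>e. Spine s \<alpha> \<in> subtree A h} \<subseteq> {\<beta>\<in>A. e \<le> h \<beta>}"
    by (auto simp: Spine_in_subtree)
  then show "finite {\<alpha>. \<exists>s\<ge>e. Spine s \<alpha> \<in> subtree A h}"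
    using assms[OF \<open>e > 0\<close>] finite_subset by blast
qed

text \<open>Either the arcs share \<open>Origin\<close>, or the set is one segment of a spine (or
  empty).\<close>

lemma connectedin_subtree:
  assumes A: "infinite A"
  shows "connectedin (hedgehog A) (subtree A h)"
proof (cases "0 \<le> second_level A h")
  case True
  define \<U> where "\<U> = insert {Origin} {spine_arc \<alpha> ` {0..s} | s \<alpha>. Spine s \<alpha> \<in> subtree A h}"
  have "connectedin (hedgehog A) (\<Union>\<U>)"
  proof (rule connectedin_Union)
    have "connectedin (hedgehog A) (spine_arc \<alpha> ` {0..s})" if "Spine s \<alpha> \<in> subtree A h" for s \<alpha>
      using that by (intro connectedin_spine_arc) (auto simp: Spine_in_subtree)
    then show "connectedin (hedgehog A) S" if "S \<in> \<U>" for S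
      using that by (auto simp: \<U>_def)
    have "Origin \<in> spine_arc \<alpha> ` {0..s}" if "Spine s \<alpha> \<in> subtree A h" for s \<alpha>
      using that by (auto simp: Spine_in_subtree spine_arc_def intro!: image_eqI[of _ _ 0])
    then have "Origin \<in> \<Inter>\<U>" by (auto simp: \<U>_def)
    then show "\<Inter>\<U> \<noteq> {}" by blast
  qed
  moreover have "\<Union>\<U> = subtree A h"
  proof
    show "\<Union>\<U> \<subseteq> subtree A h"
      using True by (auto simp: \<U>_def Origin_in_subtree Spine_in_subtree spine_arc_def)
    show "subtree A h \<subseteq> \<Union>\<U>"
    proof
      fix p assume p: "p \<in> subtree A h"
      show "p \<in> \<Union>\<U>"
      proof (cases p)
        case (Spine s \<alpha>)
        then have "0 < s" using p by (simp add: Spine_in_subtree)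
        then have "p \<in> spine_arc \<alpha> ` {0..s}"
          using Spine by (auto simp: spine_arc_def intro!: image_eqI[of _ _ s])
        then show ?thesis using p Spine by (auto simp: \<U>_def)
      qed (simp add: \<U>_def)
    qed
  qed
  ultimately show ?thesis by simp
next
  case False
  show ?thesis
  proof (cases "subtree A h = {}")
    case nonempty: False
    then obtain p where p: "p \<in> subtree A h" by blast
    then obtain s \<alpha> where sp: "p = Spine s \<alpha>" using False by (cases p) (auto simp: Origin_in_subtree)
    then have s: "0 < s" "\<alpha> \<in> A" "s \<le> h \<alpha>" using p by (simp_all add: Spine_in_subtree)
    have "subtree A h = spine_arc \<alpha> ` {- second_level A h..min 1 (h \<alpha>)}"
    proof
      show "subtree A h \<subseteq> spine_arc \<alpha> ` {- second_level A h..min 1 (h \<alpha>)}"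
      proof
        fix q assume q: "q \<in> subtree A h"
        then obtain t \<beta> where t: "q = Spine t \<beta>" using False by (cases q) (auto simp: Origin_in_subtree)
        then have "\<alpha> = \<beta>"
          using q s False by (intro second_level_unique[of A h]) (auto simp: Spine_in_subtree)
        then show "q \<in> spine_arc \<alpha> ` {- second_level A h..min 1 (h \<alpha>)}"
          using q t by (auto simp: Spine_in_subtree spine_arc_def intro!: image_eqI[of _ _ t])
      qed
      show "spine_arc \<alpha> ` {- second_level A h..min 1 (h \<alpha>)} \<subseteq> subtree A h"
        using False s by (auto simp: spine_arc_def Spine_in_subtree)
    qed
    then show ?thesis using connectedin_spine_arc[OF s(2), of "min 1 (h \<alpha>)"] by simp
  qed simp
qed

text \<open>If the second level is negative, the spine carrying the nonempty subtree is the only one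
  with nonnegative \<open>h\<close>, so it is \<open>\<alpha>\<close>. Hence the range of heights
  prescribed on that spine is nonempty.\<close>

lemma second_level_le_height:
  assumes "subtree A h \<noteq> {}" "\<alpha> \<in> A" "0 \<le> h \<alpha>"
  shows "- second_level A h \<le> h \<alpha>"
proof (cases "second_level A h < 0")
  case True
  obtain p where p: "p \<in> subtree A h" using assms(1) by blast
  then obtain s \<beta> where sp: "p = Spine s \<beta>" using True by (cases p) (auto simp: Origin_in_subtree)
  then have s: "0 < s" "\<beta> \<in> A" "s \<le> h \<beta>" "- second_level A h \<le> s"
    using p by (simp_all add: Spine_in_subtree)
  then have "\<alpha> = \<beta>" using second_level_unique[OF True] assms(2,3) by force
  then show ?thesis using s by simp
qed (use assms in simp)

lemma second_level_ge_minus_one: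
  assumes "subtree A h \<noteq> {}" shows "- second_level A h \<le> 1"
proof -
  obtain p where "p \<in> subtree A h" using assms by blast
  then have "p \<in> hedgehog_points A" "- second_level A h \<le> height UNIV p" by (auto simp: subtree_def)
  then show ?thesis using height_bounds(2)[of p A UNIV] by linarith
qed

section \<open>Continuity of the subtree mapping\<close>

text \<open>Lower semicontinuity holds because the second level is a supremum of continuous
  functions. For upper semicontinuity, all but finitely many \<open>g \<beta>\<close> stay below
  \<open>g0 + e\<close> near \<open>x\<close>; a pair containing one of these contributes little
  more than \<open>g0 x\<close>, which is itself at most the second level at
  \<open>x\<close>.\<close>

lemma continuous_map_second_level:
  assumes A: "infinite A" and X: "\<And>\<beta>. \<beta> \<in> A \<Longrightarrow> continuous_map X euclideanreal (g \<beta>)"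
    and g0: "continuous_map X euclideanreal g0"
    and g0_le: "\<And>x \<beta>. \<lbrakk>x \<in> topspace X; \<beta> \<in> A\<rbrakk> \<Longrightarrow> g0 x \<le> 0 \<and> g0 x \<le> g \<beta> x"
    and lf: "\<And>e. e > 0 \<Longrightarrow> locally_finite_family X (\<lambda>\<beta>. {x \<in> topspace X. g0 x + e \<le> g \<beta> x}) A"
  shows "continuous_map X euclideanreal (\<lambda>x. second_level A (\<lambda>\<beta>. g \<beta> x))"
  unfolding continuous_map_upper_lower_semicontinuous_lt
proof (intro allI conjI)
  let ?c = "\<lambda>x. second_level A (\<lambda>\<beta>. g \<beta> x)"
  let ?m = "\<lambda>\<gamma> \<delta> x. min (min (g \<gamma> x) (g \<delta> x)) 0"
  have m: "continuous_map X euclideanreal (?m \<gamma> \<delta>)" if "\<gamma> \<in> A" "\<delta> \<in> A" for \<gamma> \<delta>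
    using X that by (intro continuous_intros) auto
  fix a
  show "openin X {x \<in> topspace X. a < ?c x}"
  proof -
    have "{x \<in> topspace X. a < ?c x} =
        (\<Union>\<gamma>\<in>A. \<Union>\<delta>\<in>A - {\<gamma>}. {x \<in> topspace X. a < ?m \<gamma> \<delta> x})" (is "?L = ?R")
    proof
      show "?L \<subseteq> ?R"
      proof (rule subsetI, rule ccontr)
        fix x assume x: "x \<in> ?L" "x \<notin> ?R"
        have "?m \<gamma> \<delta> x \<le> a" if "\<gamma> \<in> A" "\<delta> \<in> A" "\<gamma> \<noteq> \<delta>" for \<gamma> \<delta>
        proof (rule ccontr)
          assume "\<not> ?m \<gamma> \<delta> x \<le> a"
          then have "x \<in> {x \<in> topspace X. a < ?m \<gamma> \<delta> x}" using x(1) by auto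
          then show False using x(2) that by blast
        qed
        then have "?c x \<le> a" by (rule second_level_le[OF A])
        then show False using x by auto
      qed
      show "?R \<subseteq> ?L"
      proof
        fix x assume "x \<in> ?R"
        then obtain \<gamma> \<delta> where "\<gamma> \<in> A" "\<delta> \<in> A" "\<gamma> \<noteq> \<delta>" "x \<in> topspace X" "a < ?m \<gamma> \<delta> x" by blast
        moreover from this have "?m \<gamma> \<delta> x \<le> ?c x" by (intro second_level_ge)
        ultimately have "a < ?c x" by linarith
        with \<open>x \<in> topspace X\<close> show "x \<in> ?L" by simp
      qed
    qed
    moreover have "openin X {x \<in> topspace X. a < ?m \<gamma> \<delta> x}" if "\<gamma> \<in> A" "\<delta> \<in> A" for \<gamma> \<delta>
      using m[OF that] unfolding continuous_map_upper_lower_semicontinuous_lt by blast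
    then have "openin X ?R" by (intro openin_Union ballI) auto
    ultimately show ?thesis by simp
  qed
  show "openin X {x \<in> topspace X. ?c x < a}"
  proof (subst openin_subopen, intro ballI)
    fix x assume "x \<in> {x \<in> topspace X. ?c x < a}"
    then have x: "x \<in> topspace X" "?c x < a" by auto
    \<comment> \<open>On \<open>W\<close>, pairs in \<open>P\<close> stay below
      \<open>?c x + e\<close>, and the other pairs stay below
      \<open>g0 y + e < g0 x + 2 * e\<close>. Thus the supremum is at most
      \<open>?c x + 2 * e\<close>, still less than \<open>a\<close>.\<close>
    define e where "e = (a - ?c x) / 3"
    have e: "e > 0" using x(2) by (simp add: e_def)
    obtain V where V: "openin X V" "x \<in> V"
      "finite {\<beta>\<in>A. {x \<in> topspace X. g0 x + e \<le> g \<beta> x} \<inter> V \<noteq> {}}" (is "finite ?B")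
      using x(1) lf[OF e] by (rule locally_finite_familyE)
    define P where "P = {(\<gamma>, \<delta>). \<gamma> \<in> ?B \<and> \<delta> \<in> ?B \<and> \<gamma> \<noteq> \<delta>}"
    have "P \<subseteq> ?B \<times> ?B" by (auto simp: P_def)
    then have finP: "finite P" by (rule finite_subset) (use V(3) in blast)
    \<comment> \<open>The factor \<open>topspace X\<close> keeps \<open>Q\<close> inside the space
      when \<open>P\<close> is empty.\<close>
    define Q where "Q = topspace X \<inter> (\<Inter>(\<gamma>, \<delta>)\<in>P. {y \<in> topspace X. ?m \<gamma> \<delta> y < ?c x + e})"
    define W where "W = V \<inter> {y \<in> topspace X. g0 y < g0 x + e} \<inter> Q"
    have PA: "\<gamma> \<in> A \<and> \<delta> \<in> A" if "(\<gamma>, \<delta>) \<in> P" for \<gamma> \<delta> using that by (simp add: P_def)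
    have om: "openin X {y \<in> topspace X. ?m \<gamma> \<delta> y < ?c x + e}" if "(\<gamma>, \<delta>) \<in> P" for \<gamma> \<delta>
    proof -
      have "continuous_map X euclideanreal (?m \<gamma> \<delta>)" using m PA[OF that] by simp
      then show ?thesis unfolding continuous_map_upper_lower_semicontinuous_lt by blast
    qed
    have "openin X Q"
      unfolding Q_def using finP om by (intro openin_Int_Inter) auto
    moreover have "openin X {y \<in> topspace X. g0 y < g0 x + e}"
      using g0 unfolding continuous_map_upper_lower_semicontinuous_lt by blast
    ultimately have oW: "openin X W" unfolding W_def by (intro openin_Int V)
    have xW: "x \<in> W"
    proof -
      have "?m \<gamma> \<delta> x < ?c x + e" if "(\<gamma>, \<delta>) \<in> P" for \<gamma> \<delta>
      proof -
        have "\<gamma> \<noteq> \<delta>" using that by (simp add: P_def)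
        then have "?m \<gamma> \<delta> x \<le> ?c x" using PA[OF that] by (intro second_level_ge) auto
        then show ?thesis using e by linarith
      qed
      then have "x \<in> Q" using x(1) by (auto simp: Q_def)
      then show ?thesis using x(1) V(2) e by (simp add: W_def)
    qed
    have "?c y < a" if "y \<in> W" for y
    proof -
      have y: "y \<in> topspace X" "y \<in> V" "g0 y < g0 x + e" using that by (auto simp: W_def)
      have g0x: "g0 x \<le> ?c x"
      proof -
        obtain \<gamma> where \<gamma>: "\<gamma> \<in> A" using A by (metis finite.emptyI ex_in_conv)
        obtain \<delta> where \<delta>: "\<delta> \<in> A" "\<delta> \<noteq> \<gamma>" using infinite_obtain_other[OF A] .
        show ?thesis
          using second_level_ge[OF \<gamma> \<delta>(1), of "\<lambda>\<beta>. g \<beta> x"] \<delta>(2) g0_le[OF x(1) \<gamma>] g0_le[OF x(1) \<delta>(1)]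
          by auto
      qed
      have far: "g \<beta> y < g0 y + e" if "\<beta> \<in> A" "\<beta> \<notin> ?B" for \<beta>
        using that y by force
      have "?c y \<le> ?c x + 2 * e"
      proof (rule second_level_le[OF A])
        fix \<gamma> \<delta> assume \<gamma>\<delta>: "\<gamma> \<in> A" "\<delta> \<in> A" "\<gamma> \<noteq> \<delta>"
        show "?m \<gamma> \<delta> y \<le> ?c x + 2 * e"
        proof (cases "(\<gamma>, \<delta>) \<in> P")
          case True
          moreover have "y \<in> Q" using \<open>y \<in> W\<close> by (simp add: W_def)
          ultimately have "?m \<gamma> \<delta> y < ?c x + e" unfolding Q_def by blast
          then show ?thesis using e by linarith
        next
          case False
          then have "\<gamma> \<notin> ?B \<or> \<delta> \<notin> ?B" using \<gamma>\<delta>(3) unfolding P_def by blast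
          then have "g \<gamma> y < g0 y + e \<or> g \<delta> y < g0 y + e" using far \<gamma>\<delta> by blast
          then show ?thesis using y(3) g0x by linarith
        qed
      qed
      moreover have "a = ?c x + 3 * e" by (simp add: e_def field_simps)
      ultimately show ?thesis using e by linarith
    qed
    moreover have "W \<subseteq> topspace X" using oW by (rule openin_subset)
    ultimately have "W \<subseteq> {x \<in> topspace X. ?c x < a}" by blast
    with oW xW show "\<exists>T. openin X T \<and> x \<in> T \<and> T \<subseteq> {x \<in> topspace X. ?c x < a}"
      by (intro exI[of _ W] conjI)
  qed
qed

text \<open>The pairs \<open>(a, b)\<close> whose interval meets \<open>K\<close> form the sum of
  the compact diagonal copy of \<open>K\<close> and a closed quadrant, hence a closed set; the claim
  is its preimage under \<open>(f, g)\<close>.\<close>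

lemma closedin_between_meets_compact:
  fixes f g :: "'a \<Rightarrow> real"
  assumes "continuous_map X euclideanreal f" "continuous_map X euclideanreal g" "compact K"
  shows "closedin X {x \<in> topspace X. \<exists>s\<in>K. f x \<le> s \<and> s \<le> g x}"
proof -
  have "compact ((\<lambda>s::real. (s, s)) ` K)"
    using assms(3) by (intro compact_continuous_image) (auto intro!: continuous_intros)
  moreover have "closed ({..0::real} \<times> {0::real..})" by (intro closed_Times) auto
  ultimately have cl: "closed (\<Union>u\<in>(\<lambda>s. (s, s)) ` K. \<Union>v\<in>{..0} \<times> {0..}. {u + v})"
    by (rule compact_closed_sums)
  have eq: "(\<Union>u\<in>(\<lambda>s. (s, s)) ` K. \<Union>v\<in>{..0} \<times> {0..}. {u + v}) =
      {(a, b). \<exists>s\<in>K. a \<le> s \<and> s \<le> b}" (is "?L = ?R")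
  proof
    show "?R \<subseteq> ?L"
    proof clarify
      fix a b s assume "s \<in> K" "a \<le> s" "s \<le> b"
      moreover have "(a, b) = (s, s) + (a - s, b - s)" by simp
      ultimately show "(a, b) \<in> ?L" by (intro UN_I[of "(s, s)"] UN_I[of "(a - s, b - s)"]) auto
    qed
    show "?L \<subseteq> ?R"
    proof
      fix z assume "z \<in> ?L"
      then obtain s a b where "s \<in> K" "a \<le> 0" "0 \<le> b" "z = (s, s) + (a, b)" by auto
      then show "z \<in> ?R" by (auto intro!: bexI[of _ s])
    qed
  qed
  have "continuous_map X euclidean (\<lambda>x. (f x, g x))"
    using assms(1,2) continuous_map_pairedI[of X euclidean f euclidean g]
    by (simp add: euclidean_product_topology)
  then have "closedin X {x \<in> topspace X. (f x, g x) \<in> ?R}"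
    using cl unfolding eq by (intro closedin_continuous_map_preimage) auto
  then show ?thesis by simp
qed

text \<open>At heights at least \<open>e\<close> only finitely many spines matter locally, and on
  each spine meeting \<open>F\<close> means that an interval with continuous endpoints meets a
  compact set. The origin is treated separately.\<close>

lemma usc_map_subtree:
  assumes X: "\<And>\<beta>. \<beta> \<in> A \<Longrightarrow> continuous_map X euclideanreal (g \<beta>)"
    and c: "continuous_map X euclideanreal (\<lambda>x. second_level A (\<lambda>\<beta>. g \<beta> x))"
    and lf: "\<And>e. e > 0 \<Longrightarrow> locally_finite_family X (\<lambda>\<beta>. {x \<in> topspace X. e \<le> g \<beta> x}) A"
  shows "usc_map X (hedgehog A) (\<lambda>x. subtree A (\<lambda>\<beta>. g \<beta> x))"
  unfolding usc_map_def
proof (intro allI impI)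
  fix F assume F: "closedin (hedgehog A) F"
  let ?c = "\<lambda>x. second_level A (\<lambda>\<beta>. g \<beta> x)"
  let ?\<phi> = "\<lambda>x. subtree A (\<lambda>\<beta>. g \<beta> x)"
  have c': "continuous_map X euclideanreal (\<lambda>x. - ?c x)" using c by (intro continuous_intros)
  have FA: "F \<subseteq> hedgehog_points A" using closedin_subset[OF F] by simp
  define N where "N e = {x \<in> topspace X. ?\<phi> x \<inter> (F \<inter> {p \<in> hedgehog_points A. e \<le> height UNIV p}) \<noteq> {}}" for e
  have N: "closedin X (N e)" if "e > 0" for e
  proof -
    define E where "E \<alpha> = {x \<in> topspace X. \<exists>s\<in>{s\<in>{e..1}. spine_arc \<alpha> s \<in> F}. - ?c x \<le> s \<and> s \<le> g \<alpha> x}" for \<alpha>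
    have "N e = (\<Union>\<alpha>\<in>A. E \<alpha>)"
    proof
      show "N e \<subseteq> (\<Union>\<alpha>\<in>A. E \<alpha>)"
      proof
        fix x assume x: "x \<in> N e"
        then obtain p where p: "p \<in> ?\<phi> x" "p \<in> F" "e \<le> height UNIV p" by (auto simp: N_def)
        then obtain s \<alpha> where "p = Spine s \<alpha>" using \<open>e > 0\<close> by (cases p) auto
        then show "x \<in> (\<Union>\<alpha>\<in>A. E \<alpha>)"
          using x p by (auto simp: E_def N_def Spine_in_subtree spine_arc_def intro!: bexI[of _ \<alpha>] exI[of _ s])
      qed
      show "(\<Union>\<alpha>\<in>A. E \<alpha>) \<subseteq> N e"
      proof
        fix x assume "x \<in> (\<Union>\<alpha>\<in>A. E \<alpha>)"
        then obtain \<alpha> s where "\<alpha> \<in> A" "x \<in> topspace X" "e \<le> s" "s \<le> 1" "spine_arc \<alpha> s \<in> F" "- ?c x \<le> s" "s \<le> g \<alpha> x"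
          by (auto simp: E_def)
        then have "Spine s \<alpha> \<in> ?\<phi> x \<inter> (F \<inter> {p \<in> hedgehog_points A. e \<le> height UNIV p})"
          using \<open>e > 0\<close> by (simp add: Spine_in_subtree spine_arc_def)
        then show "x \<in> N e" using \<open>x \<in> topspace X\<close> unfolding N_def by blast
      qed
    qed
    moreover have "closedin X (\<Union>\<alpha>\<in>A. E \<alpha>)"
    proof (rule closedin_Union_locally_finite_family)
      show "locally_finite_family X E A"
        by (rule locally_finite_family_subset[OF lf[OF \<open>e > 0\<close>]]) (auto simp: E_def)
      fix \<alpha> assume \<alpha>: "\<alpha> \<in> A"
      have "closedin (top_of_set {..1}) {s \<in> topspace (top_of_set {..1}). spine_arc \<alpha> s \<in> F}"
        using continuous_map_spine_arc[OF \<alpha>] F by (rule closedin_continuous_map_preimage)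
      then have "closed {s \<in> {..1}. spine_arc \<alpha> s \<in> F}"
        using closedin_closed_trans closed_atMost by fastforce
      then have "compact ({e..1} \<inter> {s \<in> {..1}. spine_arc \<alpha> s \<in> F})" by (intro compact_Int_closed) auto
      moreover have "{e..1} \<inter> {s \<in> {..1}. spine_arc \<alpha> s \<in> F} = {s\<in>{e..1}. spine_arc \<alpha> s \<in> F}" by auto
      ultimately show "closedin X (E \<alpha>)"
        unfolding E_def by (intro closedin_between_meets_compact c' X \<alpha>) simp
    qed
    ultimately show ?thesis by simp
  qed
  show "closedin X {x \<in> topspace X. ?\<phi> x \<inter> F \<noteq> {}}"
  proof (cases "Origin \<in> F")
    case False
    have "openin (hedgehog A) (hedgehog_points A - F)"
      using F by (metis closedin_def topspace_hedgehog)
    then obtain e where e: "e > 0" "\<And>p. \<lbrakk>p \<in> hedgehog_points A; height UNIV p < e\<rbrakk> \<Longrightarrow> p \<in> hedgehog_points A - F"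
      using openin_hedgehog_Origin False by (metis DiffI Origin_in_hedgehog_points)
    have "F \<inter> {p \<in> hedgehog_points A. e \<le> height UNIV p} = F"
      using e(2) FA by (force simp: not_less[symmetric])
    then show ?thesis using N[OF e(1)] by (simp add: N_def)
  next
    case True
    \<comment> \<open>Missing \<open>F\<close> forces a negative second level. All points of the
      subtree then have height at least \<open>- ?c x\<close>, so for any positive \<open>e\<close>
      below this value \<open>N e\<close> decides whether \<open>F\<close> is met; the reverse
      inclusion needs one witness, here half of \<open>- ?c x\<close>.\<close>
    have "topspace X - {x \<in> topspace X. ?\<phi> x \<inter> F \<noteq> {}} =
        (\<Union>e\<in>{0<..}. {x \<in> topspace X. e < - ?c x} \<inter> (topspace X - N e))" (is "?L = ?R")
    proof
      show "?L \<subseteq> ?R"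
      proof
        fix x assume x: "x \<in> ?L"
        then have "Origin \<notin> ?\<phi> x" using True by auto
        then have "?c x < 0" by (simp add: Origin_in_subtree)
        moreover from x have "x \<in> topspace X" "x \<notin> N (- ?c x / 2)" by (auto simp: N_def)
        ultimately have "- ?c x / 2 \<in> {0<..}"
          "x \<in> {x' \<in> topspace X. - ?c x / 2 < - ?c x'} \<inter> (topspace X - N (- ?c x / 2))"
          by simp_all
        then show "x \<in> ?R" by (rule UN_I)
      qed
      show "?R \<subseteq> ?L"
      proof
        fix x assume "x \<in> ?R"
        then obtain e where x: "x \<in> topspace X" "e < - ?c x" "x \<notin> N e" by blast
        have "p \<notin> F" if "p \<in> ?\<phi> x" for p
        proof
          assume "p \<in> F"
          moreover have "e \<le> height UNIV p" "p \<in> hedgehog_points A"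
            using that x(2) by (simp_all add: subtree_def)
          ultimately show False using that x(1,3) unfolding N_def by blast
        qed
        then show "x \<in> ?L" using x(1) by blast
      qed
    qed
    moreover have "openin X ({x \<in> topspace X. e < - ?c x} \<inter> (topspace X - N e))" if "e > 0" for e
    proof (rule openin_Int)
      show "openin X {x \<in> topspace X. e < - ?c x}"
        using c' unfolding continuous_map_upper_lower_semicontinuous_lt by blast
      show "openin X (topspace X - N e)" using N[OF that] by (rule openin_diff[OF openin_topspace])
    qed
    then have "openin X ?R" by (intro openin_Union ballI) auto
    ultimately have "openin X (topspace X - {x \<in> topspace X. ?\<phi> x \<inter> F \<noteq> {}})" by simp
    then show ?thesis unfolding closedin_def by blast
  qed
qed

text \<open>A point of the subtree at \<open>x\<close> is followed along its own spine by clamping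
  its height to the range allowed at \<open>y\<close>, whose endpoints vary continuously.\<close>

lemma lsc_map_subtree:
  assumes X: "\<And>\<beta>. \<beta> \<in> A \<Longrightarrow> continuous_map X euclideanreal (g \<beta>)"
    and c: "continuous_map X euclideanreal (\<lambda>x. second_level A (\<lambda>\<beta>. g \<beta> x))"
    and ne: "\<And>x. x \<in> topspace X \<Longrightarrow> subtree A (\<lambda>\<beta>. g \<beta> x) \<noteq> {}"
  shows "lsc_map X (hedgehog A) (\<lambda>x. subtree A (\<lambda>\<beta>. g \<beta> x))"
  unfolding lsc_map_def
proof (intro allI impI)
  fix U assume U: "openin (hedgehog A) U"
  let ?c = "\<lambda>x. second_level A (\<lambda>\<beta>. g \<beta> x)"
  let ?\<phi> = "\<lambda>x. subtree A (\<lambda>\<beta>. g \<beta> x)"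
  have oc: "openin X {y \<in> topspace X. a < ?c y}" for a
    using c unfolding continuous_map_upper_lower_semicontinuous_lt by blast
  show "openin X {x \<in> topspace X. ?\<phi> x \<inter> U \<noteq> {}}"
  proof (subst openin_subopen, intro ballI)
    fix x assume "x \<in> {x \<in> topspace X. ?\<phi> x \<inter> U \<noteq> {}}"
    then obtain p where x: "x \<in> topspace X" and p: "p \<in> ?\<phi> x" "p \<in> U" by blast
    show "\<exists>T. openin X T \<and> x \<in> T \<and> T \<subseteq> {x \<in> topspace X. ?\<phi> x \<inter> U \<noteq> {}}"
    proof (cases p)
      case Origin
      then obtain e where e: "e > 0" "\<And>p. \<lbrakk>p \<in> hedgehog_points A; height UNIV p < e\<rbrakk> \<Longrightarrow> p \<in> U"
        using openin_hedgehog_Origin[OF U] p(2) by blast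
      have "?\<phi> y \<inter> U \<noteq> {}" if y: "y \<in> topspace X" "- e < ?c y" for y
      proof (cases "Origin \<in> ?\<phi> y")
        case True
        then show ?thesis using p(2) Origin by blast
      next
        case False
        obtain q where q: "q \<in> ?\<phi> y" using ne[OF y(1)] by blast
        then obtain s \<alpha> where "q = Spine s \<alpha>" using False by (cases q) auto
        \<comment> \<open>When the subtree leaves the origin, its lowest point replaces
          \<open>Origin\<close>; its height \<open>- ?c y\<close> is less than
          \<open>e\<close>.\<close>
        then have "Spine (- ?c y) \<alpha> \<in> ?\<phi> y"
          using q False by (auto simp: Spine_in_subtree Origin_in_subtree)
        moreover from this have "Spine (- ?c y) \<alpha> \<in> U"
          using y(2) by (intro e(2)) (auto simp: Spine_in_subtree)
        ultimately show ?thesis by blast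
      qed
      moreover have "- e < ?c x" using p(1) Origin e(1) by (simp add: Origin_in_subtree)
      ultimately show ?thesis using oc[of "- e"] x by (intro exI[of _ "{y \<in> topspace X. - e < ?c y}"]) auto
    next
      case (Spine s \<alpha>)
      then have s: "0 < s" "s \<le> 1" "\<alpha> \<in> A" "- ?c x \<le> s" "s \<le> g \<alpha> x"
        using p(1) by (simp_all add: Spine_in_subtree)
      obtain d where d: "d > 0" "\<And>t. \<lbrakk>t \<le> 1; \<bar>t - s\<bar> < d\<rbrakk> \<Longrightarrow> spine_arc \<alpha> t \<in> U"
        using openin_hedgehog_Spine[OF U] p(2) Spine by blast
      \<comment> \<open>Bounding \<open>e\<close> by \<open>s\<close> keeps
        \<open>g \<alpha> y\<close> positive on \<open>?T\<close>, as
        \<open>second_level_le_height\<close> requires, and makes the clamped height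
        positive.\<close>
      define e where "e = min d s"
      have e: "0 < e" "e \<le> d" "e \<le> s" using d(1) s(1) by (auto simp: e_def)
      let ?T = "{y \<in> topspace X. s - e < g \<alpha> y} \<inter> {y \<in> topspace X. - (s + e) < ?c y}"
      have "openin X ?T"
        using X[OF s(3)] oc unfolding continuous_map_upper_lower_semicontinuous_lt
        by (intro openin_Int) auto
      moreover have "x \<in> ?T" using x s e by auto
      moreover have "?\<phi> y \<inter> U \<noteq> {}" if y: "y \<in> ?T" for y
      proof -
        define t where "t = max (- ?c y) (min s (g \<alpha> y))"
        have "y \<in> topspace X" using y by simp
        note ney = ne[OF this]
        have "0 \<le> g \<alpha> y" using y e(3) by auto
        then have "- ?c y \<le> 1" "- ?c y \<le> g \<alpha> y"
          using second_level_ge_minus_one[OF ney] second_level_le_height[OF ney s(3)] by auto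
        then have "0 < t" "t \<le> 1" "- ?c y \<le> t" "t \<le> g \<alpha> y" "\<bar>t - s\<bar> < e"
          using y s e by (auto simp: t_def)
        then have "Spine t \<alpha> \<in> ?\<phi> y" "spine_arc \<alpha> t \<in> U"
          using s(3) d(2)[of t] e(2) by (auto simp: Spine_in_subtree)
        then show ?thesis using \<open>0 < t\<close> by (auto simp: spine_arc_def)
      qed
      ultimately show ?thesis by (intro exI[of _ ?T]) auto
    qed
  qed
qed

section \<open>Set-valued mappings and real functions\<close>

text \<open>The maximum over a finite value is attained, so its superlevel sets are the sets where
  \<open>\<theta>\<close> meets a closed superlevel set of \<open>f\<close>.\<close>

lemma usc_fun_Max:
  assumes \<theta>: "usc_map X Y \<theta>" and f: "continuous_map Y euclideanreal f"
    and fin: "\<And>x. x \<in> topspace X \<Longrightarrow> finite (\<theta> x) \<and> \<theta> x \<noteq> {} \<and> \<theta> x \<subseteq> topspace Y"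
  shows "usc_fun X (\<lambda>x. Max (f ` \<theta> x))"
  unfolding usc_fun_def
proof
  fix c
  have "closedin Y {y \<in> topspace Y. c \<le> f y}"
    using f unfolding continuous_map_upper_lower_semicontinuous_le by blast
  then have "closedin X {x \<in> topspace X. \<theta> x \<inter> {y \<in> topspace Y. c \<le> f y} \<noteq> {}}"
    using \<theta> unfolding usc_map_def by blast
  moreover have "c \<le> Max (f ` \<theta> x) \<longleftrightarrow> \<theta> x \<inter> {y \<in> topspace Y. c \<le> f y} \<noteq> {}"
    if "x \<in> topspace X" for x
    using fin[OF that] by (subst Max_ge_iff) auto
  then have "{x \<in> topspace X. c \<le> Max (f ` \<theta> x)} =
      {x \<in> topspace X. \<theta> x \<inter> {y \<in> topspace Y. c \<le> f y} \<noteq> {}}" by blast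
  ultimately show "closedin X {x \<in> topspace X. c \<le> Max (f ` \<theta> x)}" by simp
qed

lemma lsc_fun_Sup:
  assumes \<Phi>: "lsc_map X Y \<Phi>" and f: "continuous_map Y euclideanreal f"
    and ne: "\<And>x. x \<in> topspace X \<Longrightarrow> \<Phi> x \<noteq> {} \<and> \<Phi> x \<subseteq> topspace Y"
    and bdd: "\<And>y. y \<in> topspace Y \<Longrightarrow> f y \<le> b"
  shows "lsc_fun X (\<lambda>x. Sup (f ` \<Phi> x))"
  unfolding lsc_fun_def
proof
  fix c
  have "openin Y {y \<in> topspace Y. c < f y}"
    using f unfolding continuous_map_upper_lower_semicontinuous_lt by blast
  then have "openin X {x \<in> topspace X. \<Phi> x \<inter> {y \<in> topspace Y. c < f y} \<noteq> {}}"
    using \<Phi> unfolding lsc_map_def by blast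
  moreover have "c < Sup (f ` \<Phi> x) \<longleftrightarrow> \<Phi> x \<inter> {y \<in> topspace Y. c < f y} \<noteq> {}"
    if "x \<in> topspace X" for x
  proof -
    have "bdd_above (f ` \<Phi> x)" using ne[OF that] bdd by (intro bdd_aboveI[of _ b]) auto
    then show ?thesis using ne[OF that] by (subst less_cSUP_iff) auto
  qed
  then have "{x \<in> topspace X. c < Sup (f ` \<Phi> x)} =
      {x \<in> topspace X. \<Phi> x \<inter> {y \<in> topspace Y. c < f y} \<noteq> {}}" by blast
  ultimately show "openin X {x \<in> topspace X. c < Sup (f ` \<Phi> x)}" by simp
qed

section \<open>Locally finite control of the heights of \<theta>\<close>

lemma locally_finite_family_Union_lessThan:
  assumes "\<And>n::nat. locally_finite_family X (F n) I"
  shows "locally_finite_family X (\<lambda>i. \<Union>n<N. F n i) I"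
proof (induction N)
  case 0
  then show ?case by (auto simp: locally_finite_family_def)
next
  case (Suc N)
  show ?case
    unfolding locally_finite_family_def
  proof
    fix x assume x: "x \<in> topspace X"
    obtain V where V: "openin X V" "x \<in> V" "finite {i\<in>I. (\<Union>n<N. F n i) \<inter> V \<noteq> {}}"
      using x Suc by (rule locally_finite_familyE)
    obtain V' where V': "openin X V'" "x \<in> V'" "finite {i\<in>I. F N i \<inter> V' \<noteq> {}}"
      using x assms by (rule locally_finite_familyE)
    have "{i\<in>I. (\<Union>n<Suc N. F n i) \<inter> (V \<inter> V') \<noteq> {}} \<subseteq>
        {i\<in>I. (\<Union>n<N. F n i) \<inter> V \<noteq> {}} \<union> {i\<in>I. F N i \<inter> V' \<noteq> {}}"
      by (auto simp: lessThan_Suc)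
    then have "finite {i\<in>I. (\<Union>n<Suc N. F n i) \<inter> (V \<inter> V') \<noteq> {}}"
      using V(3) V'(3) by (meson finite_UnI finite_subset)
    with V(1,2) V'(1,2) show "\<exists>V. openin X V \<and> x \<in> V \<and> finite {i\<in>I. (\<Union>n<Suc N. F n i) \<inter> V \<noteq> {}}"
      by (intro exI[of _ "V \<inter> V'"]) (simp add: openin_Int)
  qed
qed

text \<open>The sets where \<open>\<theta>\<close> reaches height \<open>e\<close> along a given
  spine are closed, and at each point at most \<open>k\<close> of them overlap. They are also
  locally finite, so \<open>bounded_order_expansion\<close> applies.\<close>

lemma height_expansion:
  assumes X: "collectionwise_normal \<tau> X" and A: "infinite A" "|A| \<le>o \<tau>"
    and \<theta>: "\<theta> \<in> topspace X \<rightarrow> sets_card_le k (hedgehog A)" "usc_map X (hedgehog A) \<theta>" and "e > 0"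
  shows "\<exists>U. (\<forall>\<beta>\<in>A. openin X (U \<beta>)) \<and> locally_finite_family X U A \<and>
    (\<forall>x\<in>topspace X. \<forall>\<beta>\<in>A. \<forall>p\<in>\<theta> x. e \<le> height {\<beta>} p \<longrightarrow> x \<in> U \<beta>)"
proof -
  have \<theta>x: "finite (\<theta> x)" "card (\<theta> x) \<le> k" "\<theta> x \<subseteq> hedgehog_points A" if "x \<in> topspace X" for x
    using \<theta>(1) that unfolding sets_card_le_def by auto
  define F where "F \<beta> = {x \<in> topspace X. \<theta> x \<inter> {p \<in> hedgehog_points A. e \<le> height {\<beta>} p} \<noteq> {}}" for \<beta>
  define B where "B x = (\<lambda>p. case p of Spine s \<alpha> \<Rightarrow> \<alpha>) ` (\<theta> x - {Origin})" for x
  have B: "\<alpha> \<in> B x" if "Spine s \<alpha> \<in> \<theta> x" for s \<alpha> x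
    unfolding B_def by (rule image_eqI[of _ _ "Spine s \<alpha>"]) (use that in auto)
  have finB: "finite (B x)" "card (B x) \<le> k" if "x \<in> topspace X" for x
  proof -
    have "card (B x) \<le> card (\<theta> x - {Origin})" unfolding B_def by (rule card_image_le) (use \<theta>x that in auto)
    also have "\<dots> \<le> card (\<theta> x)" using \<theta>x[OF that] by (intro card_mono) auto
    finally show "card (B x) \<le> k" using \<theta>x[OF that] by simp
    show "finite (B x)" unfolding B_def using \<theta>x[OF that] by simp
  qed
  have "\<exists>U. (\<forall>\<beta>\<in>A. openin X (U \<beta>) \<and> F \<beta> \<subseteq> U \<beta>) \<and> locally_finite_family X U A"
  proof (rule bounded_order_expansion[OF X A, where k = k])
    show "closedin X (F \<beta>)" for \<beta>
      unfolding F_def using \<theta>(2) closedin_height_ge[of A e "{\<beta>}"] unfolding usc_map_def by blast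
    show "locally_finite_family X F A"
      unfolding locally_finite_family_def
    proof
      fix x assume x: "x \<in> topspace X"
      \<comment> \<open>The finite set \<open>B x\<close> lists the spines met by
        \<open>\<theta> x\<close>. Upper semicontinuity applied to the height off all of them at
        once gives a neighbourhood where only spines in \<open>B x\<close> can be reached at height
        \<open>e\<close>.\<close>
      let ?C = "{y \<in> topspace X. \<theta> y \<inter> {p \<in> hedgehog_points A. e \<le> height (- B x) p} \<noteq> {}}"
      have "closedin X ?C"
        using \<theta>(2) closedin_height_ge[of A e "- B x"] unfolding usc_map_def by blast
      then have "openin X (topspace X - ?C)" by (rule openin_diff[OF openin_topspace])
      moreover have "height (- B x) p = 0" if "p \<in> \<theta> x" for p
        using that B by (cases p) auto
      then have "x \<in> topspace X - ?C" using x \<open>e > 0\<close> by auto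
      moreover have "\<beta> \<in> B x" if "F \<beta> \<inter> (topspace X - ?C) \<noteq> {}" for \<beta>
      proof (rule ccontr)
        assume "\<beta> \<notin> B x"
        obtain y p where y: "y \<in> topspace X" "y \<notin> ?C" "p \<in> \<theta> y" "p \<in> hedgehog_points A" "e \<le> height {\<beta>} p"
          using \<open>F \<beta> \<inter> (topspace X - ?C) \<noteq> {}\<close> unfolding F_def by blast
        then have "e \<le> height (- B x) p"
          using \<open>e > 0\<close> \<open>\<beta> \<notin> B x\<close> by (cases p) (auto split: if_splits)
        then show False using y by blast
      qed
      then have "{\<beta>\<in>A. F \<beta> \<inter> (topspace X - ?C) \<noteq> {}} \<subseteq> B x" by blast
      then have "finite {\<beta>\<in>A. F \<beta> \<inter> (topspace X - ?C) \<noteq> {}}"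
        using finB(1)[OF x] by (rule finite_subset)
      ultimately show "\<exists>V. openin X V \<and> x \<in> V \<and> finite {\<beta>\<in>A. F \<beta> \<inter> V \<noteq> {}}" by blast
    qed
    fix x assume x: "x \<in> topspace X"
    have "{\<beta>\<in>A. x \<in> F \<beta>} \<subseteq> B x"
    proof
      fix \<beta> assume "\<beta> \<in> {\<beta>\<in>A. x \<in> F \<beta>}"
      then obtain p where p: "p \<in> \<theta> x" "e \<le> height {\<beta>} p" by (auto simp: F_def)
      then show "\<beta> \<in> B x" using \<open>e > 0\<close> B by (cases p) (auto split: if_splits)
    qed
    then show "card {\<beta>\<in>A. x \<in> F \<beta>} \<le> k"
      using finB[OF x] card_mono le_trans by blast
  qed
  then obtain U where U: "\<And>\<beta>. \<beta> \<in> A \<Longrightarrow> openin X (U \<beta>) \<and> F \<beta> \<subseteq> U \<beta>" "locally_finite_family X U A"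
    by blast
  have "x \<in> U \<beta>" if "x \<in> topspace X" "\<beta> \<in> A" "p \<in> \<theta> x" "e \<le> height {\<beta>} p" for x \<beta> p
  proof -
    have "x \<in> F \<beta>" using that \<theta>x(3)[OF that(1)] by (auto simp: F_def)
    then show ?thesis using U(1) that(2) by blast
  qed
  with U show ?thesis by blast
qed

text \<open>The majorant is the supremum over \<open>n\<close> of \<open>2 * (1/2)^n\<close> on the
  open expansion for height \<open>(1/2)^n\<close>. The factor 2 covers the gap between consecutive
  powers: if \<open>n\<close> is least with \<open>e n\<close> at most the height, then the height
  is at most \<open>2 * e n\<close>.\<close>

lemma lsc_height_majorants:
  assumes X: "collectionwise_normal \<tau> X" and A: "infinite A" "|A| \<le>o \<tau>"
    and \<theta>: "\<theta> \<in> topspace X \<rightarrow> sets_card_le k (hedgehog A)" "usc_map X (hedgehog A) \<theta>"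
  obtains w where "\<And>\<beta>. \<beta> \<in> A \<Longrightarrow> lsc_fun X (w \<beta>)" "\<And>\<beta> x. 0 \<le> w \<beta> x"
    "\<And>x \<beta> p. \<lbrakk>x \<in> topspace X; \<beta> \<in> A; p \<in> \<theta> x\<rbrakk> \<Longrightarrow> height {\<beta>} p \<le> w \<beta> x"
    "\<And>e. e > 0 \<Longrightarrow> locally_finite_family X (\<lambda>\<beta>. {x \<in> topspace X. e \<le> w \<beta> x}) A"
proof -
  define e where "e n = (1/2::real)^n" for n
  have e: "0 < e n" "e (Suc n) = e n / 2" "e n \<le> 1" for n
    by (simp_all add: e_def power_le_one)
  have "\<exists>U. (\<forall>\<beta>\<in>A. openin X (U \<beta>)) \<and> locally_finite_family X U A \<and>
    (\<forall>x\<in>topspace X. \<forall>\<beta>\<in>A. \<forall>p\<in>\<theta> x. e n \<le> height {\<beta>} p \<longrightarrow> x \<in> U \<beta>)" for n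
    by (rule height_expansion[OF X A \<theta> e(1)])
  then obtain U where U: "\<And>n \<beta>. \<beta> \<in> A \<Longrightarrow> openin X (U n \<beta>)" "\<And>n. locally_finite_family X (U n) A"
    "\<And>n x \<beta> p. \<lbrakk>x \<in> topspace X; \<beta> \<in> A; p \<in> \<theta> x; e n \<le> height {\<beta>} p\<rbrakk> \<Longrightarrow> x \<in> U n \<beta>"
    by metis
  define w where "w \<beta> x = (SUP n. if x \<in> U n \<beta> then 2 * e n else 0)" for \<beta> x
  have bdd: "bdd_above (range (\<lambda>n. if x \<in> U n \<beta> then 2 * e n else 0))" for \<beta> x
    using e(3) by (intro bdd_aboveI[of _ 2]) auto
  have w_less: "c < w \<beta> x \<longleftrightarrow> (\<exists>n. c < (if x \<in> U n \<beta> then 2 * e n else 0))" for c \<beta> x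
    unfolding w_def by (subst less_cSUP_iff) (use bdd in auto)
  have w_ge: "(if x \<in> U n \<beta> then 2 * e n else 0) \<le> w \<beta> x" for n \<beta> x
    unfolding w_def by (rule cSUP_upper[OF _ bdd]) simp
  have w_nonneg: "0 \<le> w \<beta> x" for \<beta> x
    using w_ge[of x 0 \<beta>] e(1)[of 0] by (auto split: if_splits)
  show thesis
  proof (rule that[OF _ w_nonneg])
    fix \<beta> assume \<beta>: "\<beta> \<in> A"
    show "lsc_fun X (w \<beta>)"
      unfolding lsc_fun_def
    proof
      fix c :: real
      show "openin X {x \<in> topspace X. c < w \<beta> x}"
      proof (cases "c < 0")
        case True
        then have "{x \<in> topspace X. c < w \<beta> x} = topspace X"
          using w_nonneg less_le_trans by blast
        then show ?thesis by simp
      next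
        case False
        have "{x \<in> topspace X. c < w \<beta> x} = (\<Union>n\<in>{n. c < 2 * e n}. U n \<beta>)"
          using False openin_subset[OF U(1)[OF \<beta>]] unfolding w_less by (auto split: if_splits)
        then show ?thesis using U(1)[OF \<beta>] by auto
      qed
    qed
  next
    fix x \<beta> p assume x: "x \<in> topspace X" "\<beta> \<in> A" "p \<in> \<theta> x"
    then have "p \<in> hedgehog_points A" using \<theta>(1) unfolding sets_card_le_def by auto
    show "height {\<beta>} p \<le> w \<beta> x"
    proof (cases "height {\<beta>} p > 0")
      case True
      let ?P = "\<lambda>n. e n \<le> height {\<beta>} p"
      obtain m where "e m < height {\<beta>} p"
        using real_arch_pow_inv[OF True, of "1/2"] unfolding e_def by auto
      then have "?P (LEAST n. ?P n)" by (intro LeastI[of ?P m]) simp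
      define n where "n = (LEAST n. ?P n)"
      have "height {\<beta>} p \<le> 2 * e n"
      proof (cases n)
        case 0
        then show ?thesis
          using height_bounds(2)[OF \<open>p \<in> hedgehog_points A\<close>, of "{\<beta>}"] by (simp add: e_def)
      next
        case (Suc l)
        then have "\<not> ?P l" using not_less_Least[of l ?P] unfolding n_def by simp
        moreover have "2 * e n = e l" unfolding Suc using e(2)[of l] by linarith
          ultimately show ?thesis by linarith
      qed
      moreover have "x \<in> U n \<beta>"
        using U(3)[OF x] \<open>?P (LEAST n. ?P n)\<close> unfolding n_def by blast
      ultimately show ?thesis using w_ge[of x n \<beta>] by simp
    next
      case False
      then show ?thesis using w_nonneg[of \<beta> x] by linarith
    qed
  next
    fix \<epsilon> :: real assume "\<epsilon> > 0"
    \<comment> \<open>From \<open>N\<close> on, the terms are below \<open>\<epsilon> / 2\<close>,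
      so a value at least \<open>\<epsilon>\<close> must come from one of the first \<open>N\<close>
      families. Halving \<open>\<epsilon>\<close> provides the strict inequality needed to select a
      term of the supremum.\<close>
    then obtain N where N: "e N < \<epsilon> / 4"
      using real_arch_pow_inv[of "\<epsilon>/4" "1/2"] unfolding e_def by auto
    have less: "n < N" if "\<epsilon> / 2 < 2 * e n" for n
    proof (rule ccontr)
      assume "\<not> n < N"
      then have "e n \<le> e N" unfolding e_def by (intro power_decreasing) auto
      then show False using N that by linarith
    qed
    show "locally_finite_family X (\<lambda>\<beta>. {x \<in> topspace X. \<epsilon> \<le> w \<beta> x}) A"
    proof (rule locally_finite_family_subset[OF locally_finite_family_Union_lessThan[where N = N]])
      show "locally_finite_family X (U n) A" for n by (rule U(2))
      fix \<beta>
      show "{x \<in> topspace X. \<epsilon> \<le> w \<beta> x} \<subseteq> (\<Union>n<N. U n \<beta>)"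
      proof
        fix x assume "x \<in> {x \<in> topspace X. \<epsilon> \<le> w \<beta> x}"
        then have "\<epsilon> / 2 < w \<beta> x" using \<open>\<epsilon> > 0\<close> by auto
        then obtain n where n: "\<epsilon> / 2 < (if x \<in> U n \<beta> then 2 * e n else 0)" using w_less by blast
        then have "x \<in> U n \<beta>" using \<open>\<epsilon> > 0\<close> by (auto split: if_splits)
        moreover have "n < N" using n calculation by (intro less) simp
        ultimately show "x \<in> (\<Union>n<N. U n \<beta>)" by blast
      qed
    qed simp
  qed
qed

section \<open>The two implications\<close>

lemma connected_compact_sets'_cases:
  assumes "S \<in> connected_compact_sets' (hedgehog A)"
  shows "S \<noteq> {}" "S \<subseteq> hedgehog_points A"
    "S = hedgehog_points A \<or> compactin (hedgehog A) S \<and> connectedin (hedgehog A) S"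
  using assms compactin_subset_topspace[of "hedgehog A" S]
  by (auto simp: connected_compact_sets'_def connected_compact_sets_def compact_sets_def
      hedgehog_points_def)

lemma compactin_attains_Sup:
  assumes "compactin Y S" "S \<noteq> {}" "continuous_map Y euclideanreal f"
  obtains p where "p \<in> S" "Sup (f ` S) = f p"
proof -
  have "compact (f ` S)" using image_compactin[OF assms(1,3)] by simp
  then obtain p where p: "p \<in> S" "\<And>q. q \<in> S \<Longrightarrow> f q \<le> f p"
    using compact_attains_sup[of "f ` S"] assms(2) by auto
  then have "Sup (f ` S) = f p" by (intro cSup_eq_maximum) auto
  with p(1) that show thesis by blast
qed

section \<open>From collectionwise normality to the sandwich property\<close>

theorem collectionwise_normal_imp_sandwich:
  assumes \<tau>: "Cinfinite \<tau>" and A: "infinite A" "|A| \<le>o \<tau>" and X: "collectionwise_normal \<tau> X"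
    and \<Phi>: "\<Phi> \<in> topspace X \<rightarrow> connected_compact_sets' (hedgehog A)" "lsc_map X (hedgehog A) \<Phi>"
    and \<theta>: "\<theta> \<in> topspace X \<rightarrow> sets_card_le k (hedgehog A)" "usc_map X (hedgehog A) \<theta>"
    and \<theta>\<Phi>: "submap X \<theta> \<Phi>"
  obtains \<phi> where "\<phi> \<in> topspace X \<rightarrow> connected_compact_sets (hedgehog A)"
    "continuous_set_map X (hedgehog A) \<phi>" "submap X \<theta> \<phi>" "submap X \<phi> \<Phi>"
proof -
  have N: "normal_space X" by (rule collectionwise_normal_imp_normal[OF X \<tau>])
  have \<Phi>x: "\<Phi> x \<noteq> {} \<and> \<Phi> x \<subseteq> hedgehog_points A" if "x \<in> topspace X" for x
    using \<Phi>(1) that connected_compact_sets'_cases(1,2) by (metis PiE)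
  have \<theta>x: "finite (\<theta> x) \<and> \<theta> x \<noteq> {} \<and> \<theta> x \<subseteq> hedgehog_points A" if "x \<in> topspace X" for x
    using \<theta>(1) that unfolding sets_card_le_def by auto
  let ?n = "\<lambda>p. - height UNIV p"
  define U where "U f x = Max (f ` \<theta> x)" for f :: "_ \<Rightarrow> real" and x
  define V where "V f x = Sup (f ` \<Phi> x)" for f :: "_ \<Rightarrow> real" and x
  have n: "continuous_map (hedgehog A) euclideanreal ?n" by (intro continuous_intros)
  have usc: "usc_fun X (U f)" if "continuous_map (hedgehog A) euclideanreal f" for f
    unfolding U_def using \<theta>x by (intro usc_fun_Max[OF \<theta>(2) that]) auto
  have lsc: "lsc_fun X (V f)" if "continuous_map (hedgehog A) euclideanreal f"
    "\<And>p. p \<in> hedgehog_points A \<Longrightarrow> f p \<le> 1" for f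
    unfolding V_def using \<Phi>x that(2) by (intro lsc_fun_Sup[OF \<Phi>(2) that(1)]) auto
  have Ule: "U f x \<le> b" if "x \<in> topspace X" "\<And>p. p \<in> \<theta> x \<Longrightarrow> f p \<le> b" for f x b
    unfolding U_def using \<theta>x[OF that(1)] that(2) by simp
  have Uge: "f p \<le> U f x" if "x \<in> topspace X" "p \<in> \<theta> x" for f x p
    unfolding U_def using \<theta>x[OF that(1)] that(2) by simp
  have Vle: "V f x \<le> b" if "x \<in> topspace X" "\<And>p. p \<in> hedgehog_points A \<Longrightarrow> f p \<le> b" for f x b
    unfolding V_def using \<Phi>x[OF that(1)] that(2) by (intro cSUP_least) auto
  have UV: "U f x \<le> V f x" if x: "x \<in> topspace X" and "\<And>p. p \<in> hedgehog_points A \<Longrightarrow> f p \<le> 1" for f x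
  proof (rule Ule[OF x])
    fix p assume "p \<in> \<theta> x"
    with \<theta>\<Phi> x have "p \<in> \<Phi> x" unfolding submap_def by blast
    then show "f p \<le> V f x"
      unfolding V_def using \<Phi>x[OF x] that(2) by (intro cSUP_upper bdd_aboveI[of _ 1]) auto
  qed
  have U_ge: "-1 \<le> U ?n x" if x: "x \<in> topspace X" for x
  proof -
    obtain p where "p \<in> \<theta> x" "p \<in> hedgehog_points A" using \<theta>x[OF x] by blast
    then show ?thesis using Uge[OF x, of p ?n] height_bounds(2)[of p A UNIV] by linarith
  qed
  have n_le: "?n p \<le> 0" "?n p \<le> 1" if "p \<in> hedgehog_points A" for p
    using height_bounds(1)[OF that, of UNIV] by simp_all
  have "-1 \<le> U ?n x \<and> U ?n x \<le> V ?n x \<and> V ?n x \<le> 0" if x: "x \<in> topspace X" for x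
    using U_ge[OF x] UV[of x ?n, OF x n_le(2)] Vle[of x ?n 0, OF x n_le(1)] by blast
  \<comment> \<open>The function \<open>g0\<close> is a continuous substitute for minus the distance
    to the origin. It will be a common lower bound of all \<open>g \<beta>\<close>, from which only
    locally finitely many of them rise appreciably.\<close>
  from Katetov_Tong_insertion[OF N usc[OF n] lsc[OF n n_le(2)] this]
  obtain g0 where g0: "continuous_map X euclideanreal g0"
    and g0b: "\<And>x. x \<in> topspace X \<Longrightarrow> U ?n x \<le> g0 x \<and> g0 x \<le> V ?n x"
    by auto
  have g0_le: "g0 x \<le> 0" if x: "x \<in> topspace X" for x
    using g0b[OF x] Vle[of x ?n 0, OF x n_le(1)] by linarith
  obtain w where w: "\<And>\<beta>. \<beta> \<in> A \<Longrightarrow> lsc_fun X (w \<beta>)" "\<And>\<beta> x. 0 \<le> w \<beta> x"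
    "\<And>x \<beta> p. \<lbrakk>x \<in> topspace X; \<beta> \<in> A; p \<in> \<theta> x\<rbrakk> \<Longrightarrow> height {\<beta>} p \<le> w \<beta> x"
    "\<And>e. e > 0 \<Longrightarrow> locally_finite_family X (\<lambda>\<beta>. {x \<in> topspace X. e \<le> w \<beta> x}) A"
    using lsc_height_majorants[OF X A \<theta>] by blast
  \<comment> \<open>The bound \<open>g0 x + 2 * w \<beta> x\<close> reflects the formula for
    \<open>level\<close>: \<open>g0\<close> dominates minus the distance to the origin on
    \<open>\<theta> x\<close>, and \<open>w \<beta>\<close> dominates the height along
    \<open>\<beta>\<close>. It carries the local finiteness of \<open>w\<close> over to
    \<open>g\<close>.\<close>
  have "\<exists>g. continuous_map X euclideanreal g \<and>
      (\<forall>x\<in>topspace X. max (U (level \<beta>) x) (g0 x) \<le> g x \<and> g x \<le> min (V (level \<beta>) x) (g0 x + 2 * w \<beta> x))"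
    if \<beta>: "\<beta> \<in> A" for \<beta>
  proof -
    note lb = level_bounds(2)[where \<beta> = \<beta> and A = A]
    have u: "usc_fun X (\<lambda>x. max (U (level \<beta>) x) (g0 x))"
      by (intro usc_fun_max usc continuous_map_level continuous_imp_usc_fun g0)
    have l: "lsc_fun X (\<lambda>x. min (V (level \<beta>) x) (g0 x + 2 * w \<beta> x))"
      using lb by (intro lsc_fun_min lsc lsc_fun_add lsc_fun_cmult w(1) \<beta> continuous_map_level
          continuous_imp_lsc_fun g0) auto
    have b: "-1 \<le> max (U (level \<beta>) x) (g0 x) \<and>
        max (U (level \<beta>) x) (g0 x) \<le> min (V (level \<beta>) x) (g0 x + 2 * w \<beta> x) \<and>
        min (V (level \<beta>) x) (g0 x + 2 * w \<beta> x) \<le> 1" if x: "x \<in> topspace X" for x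
    proof -
      \<comment> \<open>Every level is at least minus the distance to the origin; this makes the
        lower bound \<open>g0\<close> compatible with the upper bound from
        \<open>\<Phi>\<close>.\<close>
      have "V ?n x \<le> V (level \<beta>) x"
        unfolding V_def
      proof (intro cSUP_mono)
        show "bdd_above (level \<beta> ` \<Phi> x)" using lb \<Phi>x[OF x] by (intro bdd_aboveI[of _ 1]) auto
        fix p assume "p \<in> \<Phi> x"
        moreover from this have "0 \<le> height {\<beta>} p" using \<Phi>x[OF x] by (intro height_bounds) auto
        ultimately show "\<exists>q\<in>\<Phi> x. ?n p \<le> level \<beta> q" by (auto simp: level_def intro!: bexI[of _ p])
      qed (use \<Phi>x[OF x] in simp)
      moreover have "U (level \<beta>) x \<le> g0 x + 2 * w \<beta> x"
      proof (rule Ule[OF x])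
        fix p assume p: "p \<in> \<theta> x"
        show "level \<beta> p \<le> g0 x + 2 * w \<beta> x"
          using w(3)[OF x \<beta> p] Uge[OF x p, of ?n] g0b[OF x] unfolding level_def by linarith
      qed
      ultimately show ?thesis
        using g0b[OF x] U_ge[OF x] UV[of x "level \<beta>", OF x lb] Vle[of x "level \<beta>" 1, OF x lb]
          w(2)[of \<beta> x] by auto
    qed
    show ?thesis by (rule Katetov_Tong_insertion[OF N u l b])
  qed
  then have "\<forall>\<beta>\<in>A. \<exists>g. continuous_map X euclideanreal g \<and>
      (\<forall>x\<in>topspace X. max (U (level \<beta>) x) (g0 x) \<le> g x \<and> g x \<le> min (V (level \<beta>) x) (g0 x + 2 * w \<beta> x))"
    by blast
  from bchoice[OF this] obtain g where g: "\<And>\<beta>. \<beta> \<in> A \<Longrightarrow> continuous_map X euclideanreal (g \<beta>)"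
    and gb: "\<And>\<beta> x. \<lbrakk>\<beta> \<in> A; x \<in> topspace X\<rbrakk> \<Longrightarrow>
      max (U (level \<beta>) x) (g0 x) \<le> g \<beta> x \<and> g \<beta> x \<le> min (V (level \<beta>) x) (g0 x + 2 * w \<beta> x)"
    by blast
  have lf0: "locally_finite_family X (\<lambda>\<beta>. {x \<in> topspace X. g0 x + e \<le> g \<beta> x}) A" if "e > 0" for e
  proof (rule locally_finite_family_subset[OF w(4)[of "e / 2"]])
    show "{x \<in> topspace X. g0 x + e \<le> g \<beta> x} \<subseteq> {x \<in> topspace X. e / 2 \<le> w \<beta> x}" if "\<beta> \<in> A" for \<beta>
      using gb[OF that] by force
  qed (use that in auto)
  have lf: "locally_finite_family X (\<lambda>\<beta>. {x \<in> topspace X. e \<le> g \<beta> x}) A" if "e > 0" for e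
    by (rule locally_finite_family_subset[OF lf0[OF that]]) (use g0_le in force)+
  define \<phi> where "\<phi> x = subtree A (\<lambda>\<beta>. g \<beta> x)" for x
  have \<theta>\<phi>: "\<theta> x \<subseteq> \<phi> x" if x: "x \<in> topspace X" for x
  proof
    fix p assume p: "p \<in> \<theta> x"
    show "p \<in> \<phi> x"
      unfolding \<phi>_def
    proof (rule subset_subtree[OF A(1)])
      show "p \<in> hedgehog_points A" using p \<theta>x[OF x] by blast
      show "level \<beta> p \<le> g \<beta> x" if "\<beta> \<in> A" for \<beta>
        using Uge[OF x p, of "level \<beta>"] gb[OF that x] by linarith
    qed
  qed
  have ne: "\<phi> x \<noteq> {}" if "x \<in> topspace X" for x using \<theta>\<phi>[OF that] \<theta>x[OF that] by blast
  have \<phi>\<Phi>: "\<phi> x \<subseteq> \<Phi> x" if x: "x \<in> topspace X" for x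
  proof (cases "\<Phi> x = hedgehog_points A")
    case True
    then show ?thesis by (auto simp: \<phi>_def subtree_def)
  next
    case False
    then have S: "compactin (hedgehog A) (\<Phi> x)" "connectedin (hedgehog A) (\<Phi> x)"
      using connected_compact_sets'_cases(3)[of "\<Phi> x" A] \<Phi>(1) x by auto
    show ?thesis
      unfolding \<phi>_def
    proof (rule subtree_subset[OF A(1) S])
      fix \<beta> assume \<beta>: "\<beta> \<in> A"
      \<comment> \<open>Compactness turns the bound by the supremum over \<open>\<Phi> x\<close>
        into a bound by an actual point, as \<open>subtree_subset\<close> requires.\<close>
      obtain p where "p \<in> \<Phi> x" "Sup (level \<beta> ` \<Phi> x) = level \<beta> p"
        using compactin_attains_Sup[OF S(1) _ continuous_map_level] \<Phi>x[OF x] by blast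
      then show "\<exists>p\<in>\<Phi> x. g \<beta> x \<le> level \<beta> p" using gb[OF \<beta> x] by (auto simp: V_def)
    qed
  qed
  have c: "continuous_map X euclideanreal (\<lambda>x. second_level A (\<lambda>\<beta>. g \<beta> x))"
    using gb g0_le by (intro continuous_map_second_level[OF A(1) g g0 _ lf0]) auto
  show thesis
  proof (rule that[of \<phi>])
    have "finite {\<beta>\<in>A. e \<le> g \<beta> x}" if x: "x \<in> topspace X" and "e > 0" for x e
    proof -
      obtain V where "openin X V" "x \<in> V" "finite {\<beta>\<in>A. {x \<in> topspace X. e \<le> g \<beta> x} \<inter> V \<noteq> {}}"
        using x lf[OF \<open>e > 0\<close>] by (rule locally_finite_familyE)
      moreover have "{\<beta>\<in>A. e \<le> g \<beta> x} \<subseteq> {\<beta>\<in>A. {x \<in> topspace X. e \<le> g \<beta> x} \<inter> V \<noteq> {}}"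
        using x \<open>x \<in> V\<close> by blast
      ultimately show ?thesis by (meson finite_subset)
    qed
    then have "compactin (hedgehog A) (\<phi> x)" if "x \<in> topspace X" for x
      unfolding \<phi>_def using that by (intro compactin_subtree) auto
    then show "\<phi> \<in> topspace X \<rightarrow> connected_compact_sets (hedgehog A)"
      using ne connectedin_subtree[OF A(1)]
      by (auto simp: connected_compact_sets_def compact_sets_def \<phi>_def)
    show "continuous_set_map X (hedgehog A) \<phi>"
      unfolding continuous_set_map_def \<phi>_def
      using usc_map_subtree[OF g c lf] lsc_map_subtree[OF g c] ne unfolding \<phi>_def by blast
    show "submap X \<theta> \<phi>" "submap X \<phi> \<Phi>" using \<theta>\<phi> \<phi>\<Phi> by (simp_all add: submap_def)
  qed
qed

section \<open>From the sandwich property to collectionwise normality\<close>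

theorem sandwich_imp_collectionwise_normal:
  fixes A :: "'c set" and X :: "'a topology"
  assumes card: "\<tau> \<le>o |A|"
    and sandwich: "\<And>\<Phi> \<theta>. \<lbrakk>\<Phi> \<in> topspace X \<rightarrow> connected_compact_sets' (hedgehog A); lsc_map X (hedgehog A) \<Phi>;
      \<theta> \<in> topspace X \<rightarrow> sets_card_le 2 (hedgehog A); usc_map X (hedgehog A) \<theta>; submap X \<theta> \<Phi>\<rbrakk> \<Longrightarrow>
      \<exists>\<phi>. \<phi> \<in> topspace X \<rightarrow> connected_compact_sets (hedgehog A) \<and> continuous_set_map X (hedgehog A) \<phi> \<and>
        submap X \<theta> \<phi> \<and> submap X \<phi> \<Phi>"
  shows "collectionwise_normal \<tau> X"
  unfolding collectionwise_normal_def
proof (intro allI impI, elim conjE)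
  fix \<F> :: "'a set set"
  assume cl: "\<forall>F\<in>\<F>. closedin X F" and disc: "discrete_family X (\<lambda>F. F) \<F>" and "|\<F>| \<le>o \<tau>"
  then have "|\<F>| \<le>o |A|" using card ordLeq_transitive by blast
  then obtain f where f: "inj_on f \<F>" "f ` \<F> \<subseteq> A" by (metis card_of_ordLeq)
  have fA: "f F \<in> A" if "F \<in> \<F>" for F using f(2) that by blast
  have disj: "F = G" if "F \<in> \<F>" "G \<in> \<F>" "x \<in> F" "x \<in> G" for F G x
  proof -
    have "x \<in> topspace X" using cl that closedin_subset by blast
    then obtain V where "openin X V" "x \<in> V"
      "\<And>i j. \<lbrakk>i \<in> \<F>; j \<in> \<F>; i \<inter> V \<noteq> {}; j \<inter> V \<noteq> {}\<rbrakk> \<Longrightarrow> i = j"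
      using disc by (rule discrete_familyE) blast
    then show ?thesis using that by blast
  qed
  have closed_Union: "closedin X (\<Union>F\<in>\<G>. F)" if "\<G> \<subseteq> \<F>" for \<G>
    using that cl locally_finite_family_subset[OF discrete_imp_locally_finite_family[OF disc]]
    by (intro closedin_Union_locally_finite_family) auto
  \<comment> \<open>Members of a discrete family are disjoint, so the description is unique on the
    union; elsewhere its value is never consulted.\<close>
  define sel where "sel x = (THE F. F \<in> \<F> \<and> x \<in> F)" for x
  have sel: "sel x = F" if "F \<in> \<F>" "x \<in> F" for x F
    unfolding sel_def using that disj by (intro the_equality) auto
  define \<Phi> where "\<Phi> x = (if x \<in> \<Union>\<F> then spine_arc (f (sel x)) ` {0..1} else hedgehog_points A)" for x
  define \<theta> where "\<theta> x = (if x \<in> \<Union>\<F> then {Origin, Spine 1 (f (sel x))} else {Origin})" for x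
  have \<Phi>F: "\<Phi> x = spine_arc (f F) ` {0..1}" and \<theta>F: "\<theta> x = {Origin, Spine 1 (f F)}"
    if "F \<in> \<F>" "x \<in> F" for x F
    using that sel[OF that] by (auto simp: \<Phi>_def \<theta>_def)
  have \<Phi>n: "\<Phi> x = hedgehog_points A" and \<theta>n: "\<theta> x = {Origin}" if "x \<notin> \<Union>\<F>" for x
    using that by (auto simp: \<Phi>_def \<theta>_def)
  have Or: "Origin \<in> spine_arc \<alpha> ` {0..1}" "Spine 1 \<alpha> \<in> spine_arc \<alpha> ` {0..1}" for \<alpha> :: 'c
    by (auto simp: spine_arc_def intro: image_eqI[of _ _ 0] image_eqI[of _ _ 1])
  have arcA: "spine_arc \<alpha> ` {0..1} \<subseteq> hedgehog_points A" if "\<alpha> \<in> A" for \<alpha>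
    using that by (auto simp: spine_arc_def)
  have "\<Phi> x \<in> connected_compact_sets' (hedgehog A)" for x
  proof (cases "x \<in> \<Union>\<F>")
    case True
    then obtain F where F: "F \<in> \<F>" "x \<in> F" by blast
    then have "\<Phi> x \<in> connected_compact_sets (hedgehog A)"
      using compactin_spine_arc[OF fA[OF F(1)]] connectedin_spine_arc[OF fA[OF F(1)]]
      by (simp add: \<Phi>F connected_compact_sets_def compact_sets_def)
    then show ?thesis by (simp add: connected_compact_sets'_def)
  qed (simp add: \<Phi>n connected_compact_sets'_def)
  moreover have "\<theta> x \<in> sets_card_le 2 (hedgehog A)" for x
  proof (cases "x \<in> \<Union>\<F>")
    case True
    then obtain F where F: "F \<in> \<F>" "x \<in> F" by blast
    then show ?thesis using fA[OF F(1)] by (simp add: \<theta>F sets_card_le_def)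
  qed (simp add: \<theta>n sets_card_le_def)
  moreover have "lsc_map X (hedgehog A) \<Phi>"
    unfolding lsc_map_def
  proof (intro allI impI)
    fix U assume "openin (hedgehog A) U"
    then have U: "U \<subseteq> hedgehog_points A" using openin_subset by fastforce
    show "openin X {x \<in> topspace X. \<Phi> x \<inter> U \<noteq> {}}"
    proof (cases "U = {}")
      case False
      \<comment> \<open>A nonempty open \<open>U\<close> meets the whole hedgehog, so
        \<open>\<Phi>\<close> misses \<open>U\<close> only on those members of the family whose arcs
        miss \<open>U\<close>.\<close>
      define \<G> where "\<G> = {F \<in> \<F>. spine_arc (f F) ` {0..1} \<inter> U = {}}"
      have "\<Phi> x \<inter> U = {} \<longleftrightarrow> x \<in> (\<Union>F\<in>\<G>. F)" for x
      proof (cases "x \<in> \<Union>\<F>")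
        case True
        then obtain F where F: "F \<in> \<F>" "x \<in> F" by blast
        then have "x \<in> (\<Union>F\<in>\<G>. F) \<longleftrightarrow> F \<in> \<G>" using disj unfolding \<G>_def by blast
        then show ?thesis using F by (simp add: \<Phi>F \<G>_def)
      next
        case False
        then have "x \<notin> (\<Union>F\<in>\<G>. F)" unfolding \<G>_def by blast
        then show ?thesis using U \<open>U \<noteq> {}\<close> \<Phi>n[OF False] by auto
      qed
      then have "{x \<in> topspace X. \<Phi> x \<inter> U \<noteq> {}} = topspace X - (\<Union>F\<in>\<G>. F)" by blast
      moreover have "closedin X (\<Union>F\<in>\<G>. F)" by (rule closed_Union) (auto simp: \<G>_def)
      ultimately show ?thesis by (simp add: openin_diff)
    qed simp
  qed
  moreover have "usc_map X (hedgehog A) \<theta>"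
    unfolding usc_map_def
  proof (intro allI impI)
    fix C assume "closedin (hedgehog A) C"
    show "closedin X {x \<in> topspace X. \<theta> x \<inter> C \<noteq> {}}"
    proof (cases "Origin \<in> C")
      case True
      then have "{x \<in> topspace X. \<theta> x \<inter> C \<noteq> {}} = topspace X" by (auto simp: \<theta>_def)
      then show ?thesis by simp
    next
      case False
      define \<G> where "\<G> = {F \<in> \<F>. Spine 1 (f F) \<in> C}"
      have "\<theta> x \<inter> C \<noteq> {} \<longleftrightarrow> x \<in> (\<Union>F\<in>\<G>. F)" for x
      proof (cases "x \<in> \<Union>\<F>")
        case True
        then obtain F where F: "F \<in> \<F>" "x \<in> F" by blast
        then have "x \<in> (\<Union>F\<in>\<G>. F) \<longleftrightarrow> F \<in> \<G>" using disj unfolding \<G>_def by blast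
        then show ?thesis using F \<open>Origin \<notin> C\<close> by (simp add: \<theta>F \<G>_def)
      next
        case False
        then have "x \<notin> (\<Union>F\<in>\<G>. F)" unfolding \<G>_def by blast
        then show ?thesis using \<open>Origin \<notin> C\<close> \<theta>n[OF False] by auto
      qed
      moreover have "closedin X (\<Union>F\<in>\<G>. F)" by (rule closed_Union) (auto simp: \<G>_def)
      moreover from this have "(\<Union>F\<in>\<G>. F) \<subseteq> topspace X" by (rule closedin_subset)
      ultimately have "{x \<in> topspace X. \<theta> x \<inter> C \<noteq> {}} = (\<Union>F\<in>\<G>. F)" by blast
      then show ?thesis using \<open>closedin X (\<Union>F\<in>\<G>. F)\<close> by simp
    qed
  qed
  moreover have "submap X \<theta> \<Phi>"
    unfolding submap_def
  proof
    fix x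
    show "\<theta> x \<subseteq> \<Phi> x"
    proof (cases "x \<in> \<Union>\<F>")
      case True
      then obtain F where F: "F \<in> \<F>" "x \<in> F" by blast
      then show ?thesis using Or by (simp add: \<theta>F \<Phi>F)
    qed (simp add: \<theta>n \<Phi>n)
  qed
  ultimately obtain \<phi> where \<phi>: "continuous_set_map X (hedgehog A) \<phi>"
    and \<theta>\<phi>: "submap X \<theta> \<phi>" and \<phi>\<Phi>: "submap X \<phi> \<Phi>"
    using sandwich[of \<Phi> \<theta>] by auto
  let ?hi = "\<lambda>c B. {p \<in> hedgehog_points A. c < height B p}"
  let ?cl = "\<lambda>c B. {p \<in> hedgehog_points A. c \<le> height B p}"
  have hit: "openin X {x \<in> topspace X. \<phi> x \<inter> ?hi c B \<noteq> {}}" for c B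
    using \<phi> openin_height_gt[of A c B] unfolding continuous_set_map_def lsc_map_def by blast
  have miss: "openin X {x \<in> topspace X. \<phi> x \<inter> ?cl c B = {}}" for c B
  proof -
    have "closedin X {x \<in> topspace X. \<phi> x \<inter> ?cl c B \<noteq> {}}"
      using \<phi> closedin_height_ge[of A c B] unfolding continuous_set_map_def usc_map_def by blast
    then have "openin X (topspace X - {x \<in> topspace X. \<phi> x \<inter> ?cl c B \<noteq> {}})"
      by (rule openin_diff[OF openin_topspace])
    moreover have "topspace X - {x \<in> topspace X. \<phi> x \<inter> ?cl c B \<noteq> {}} = {x \<in> topspace X. \<phi> x \<inter> ?cl c B = {}}"
      by blast
    ultimately show ?thesis by simp
  qed
  \<comment> \<open>The thresholds leave room on both sides: above 3/4 along the own spine and below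
    1/4 off it, with 1/2 in between for the discreteness argument.\<close>
  define U where "U F = {x \<in> topspace X. \<phi> x \<inter> ?hi (3/4) {f F} \<noteq> {}} \<inter>
      {x \<in> topspace X. \<phi> x \<inter> ?cl (1/4) (- {f F}) = {}}" for F
  have "openin X (U F) \<and> F \<subseteq> U F" if F: "F \<in> \<F>" for F
  proof
    show "openin X (U F)" unfolding U_def by (intro openin_Int hit miss)
    show "F \<subseteq> U F"
    proof
      fix x assume x: "x \<in> F"
      then have xX: "x \<in> topspace X" using cl F closedin_subset by blast
      have "Spine 1 (f F) \<in> \<phi> x" using \<theta>\<phi> xX \<theta>F[OF F x] by (auto simp: submap_def)
      then have "\<phi> x \<inter> ?hi (3/4) {f F} \<noteq> {}" using fA[OF F] by auto
      moreover have "height (- {f F}) p = 0" if "p \<in> \<phi> x" for p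
      proof -
        have "p \<in> spine_arc (f F) ` {0..1}"
          using \<phi>\<Phi> xX \<Phi>F[OF F x] that unfolding submap_def by blast
        then show ?thesis by (auto simp: spine_arc_def)
      qed
      then have "\<phi> x \<inter> ?cl (1/4) (- {f F}) = {}" by auto
      ultimately show "x \<in> U F" using xX by (simp add: U_def)
    qed
  qed
  moreover have "discrete_family X U \<F>"
    unfolding discrete_family_def
  proof (intro conjI ballI)
    show "U F \<subseteq> topspace X" for F by (auto simp: U_def)
  next
    fix x assume x: "x \<in> topspace X"
    show "\<exists>V. openin X V \<and> x \<in> V \<and> (\<forall>i\<in>\<F>. \<forall>j\<in>\<F>. U i \<inter> V \<noteq> {} \<and> U j \<inter> V \<noteq> {} \<longrightarrow> i = j)"
    \<comment> \<open>If \<open>\<phi> x\<close> exceeds 1/4 along two spines, this persists nearby,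
      and every \<open>F\<close> has one of them as a foreign spine, so no \<open>U F\<close> meets
      the neighbourhood. Otherwise \<open>\<phi> x\<close> stays below 1/2 off a single spine, which
      also persists and leaves only that spine for heights above 3/4.\<close>
    proof (cases "\<exists>\<alpha> \<beta>. \<alpha> \<noteq> \<beta> \<and> \<phi> x \<inter> ?hi (1/4) {\<alpha>} \<noteq> {} \<and> \<phi> x \<inter> ?hi (1/4) {\<beta>} \<noteq> {}")
      case True
      then obtain \<alpha> \<beta> where ab: "\<alpha> \<noteq> \<beta>" "\<phi> x \<inter> ?hi (1/4) {\<alpha>} \<noteq> {}" "\<phi> x \<inter> ?hi (1/4) {\<beta>} \<noteq> {}" by blast
      let ?V = "{y \<in> topspace X. \<phi> y \<inter> ?hi (1/4) {\<alpha>} \<noteq> {}} \<inter> {y \<in> topspace X. \<phi> y \<inter> ?hi (1/4) {\<beta>} \<noteq> {}}"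
      have out: "y \<notin> U F" if \<gamma>: "\<gamma> \<noteq> f F" "\<phi> y \<inter> ?hi (1/4) {\<gamma>} \<noteq> {}" for y F \<gamma>
      proof -
        obtain p where p: "p \<in> \<phi> y" "p \<in> hedgehog_points A" "1/4 < height {\<gamma>} p" using \<gamma>(2) by blast
        then have "1/4 \<le> height (- {f F}) p" using \<gamma>(1) by (cases p) (auto split: if_splits)
        then show ?thesis using p unfolding U_def by blast
      qed
      have "U F \<inter> ?V = {}" for F
        using out[of \<alpha> F] out[of \<beta> F] ab(1) by (cases "\<alpha> = f F") auto
      moreover have "openin X ?V" by (intro openin_Int hit)
      moreover have "x \<in> ?V" using x ab by simp
      ultimately show ?thesis by (intro exI[of _ ?V]) simp
    next
      case False
      \<comment> \<open>If no spine is reached beyond 1/4, the choice is arbitrary, and the next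
        claim holds for every spine.\<close>
      define \<alpha> where "\<alpha> = (SOME \<alpha>. \<phi> x \<inter> ?hi (1/4) {\<alpha>} \<noteq> {})"
      have \<alpha>: "\<phi> x \<inter> ?hi (1/4) {\<beta>} = {}" if "\<beta> \<noteq> \<alpha>" for \<beta>
      proof (rule ccontr)
        assume \<beta>: "\<phi> x \<inter> ?hi (1/4) {\<beta>} \<noteq> {}"
        then have "\<phi> x \<inter> ?hi (1/4) {\<alpha>} \<noteq> {}" unfolding \<alpha>_def by (rule someI)
        with \<beta> that False show False by blast
      qed
      let ?V = "{y \<in> topspace X. \<phi> y \<inter> ?cl (1/2) (- {\<alpha>}) = {}}"
      have "\<phi> x \<inter> ?cl (1/2) (- {\<alpha>}) = {}"
      proof (rule ccontr)
        assume "\<phi> x \<inter> ?cl (1/2) (- {\<alpha>}) \<noteq> {}"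
        then obtain p where p: "p \<in> \<phi> x" "p \<in> hedgehog_points A" "1/2 \<le> height (- {\<alpha>}) p" by blast
        then obtain s \<beta> where "p = Spine s \<beta>" "\<beta> \<noteq> \<alpha>" "1/2 \<le> s" by (cases p) (auto split: if_splits)
        then show False using \<alpha>[of \<beta>] p by auto
      qed
      then have "x \<in> ?V" using x by simp
      have meets: "f F = \<alpha>" if "U F \<inter> ?V \<noteq> {}" for F
      proof (rule ccontr)
        assume "f F \<noteq> \<alpha>"
        obtain y p where y: "y \<in> ?V" "p \<in> \<phi> y" "p \<in> hedgehog_points A" "3/4 < height {f F} p"
          using \<open>U F \<inter> ?V \<noteq> {}\<close> unfolding U_def by blast
        then have "1/2 \<le> height (- {\<alpha>}) p" using \<open>f F \<noteq> \<alpha>\<close> by (cases p) (auto split: if_splits)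
        then show False using y by blast
      qed
      have "\<forall>i\<in>\<F>. \<forall>j\<in>\<F>. U i \<inter> ?V \<noteq> {} \<and> U j \<inter> ?V \<noteq> {} \<longrightarrow> i = j"
      proof (intro ballI impI, elim conjE)
        fix i j assume ij: "i \<in> \<F>" "j \<in> \<F>" and "U i \<inter> ?V \<noteq> {}" "U j \<inter> ?V \<noteq> {}"
        then have "f i = f j" using meets[of i] meets[of j] by simp
        then show "i = j" using f(1) ij by (simp add: inj_on_eq_iff)
      qed
      then show ?thesis by (intro exI[of _ ?V] conjI miss \<open>x \<in> ?V\<close>)
    qed
  qed
  ultimately show "\<exists>U. (\<forall>F\<in>\<F>. openin X (U F) \<and> F \<subseteq> U F) \<and> discrete_family X U \<F>" by blast
qed

theorem theorem1p3:
  fixes \<tau> :: "'t rel" and A :: "'c set" and X :: "'a topology"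
  assumes "Cinfinite \<tau>" and "|A| =o \<tau>"
    and "Hausdorff_space X" and "infinite (topspace X)"
  shows "collectionwise_normal \<tau> X \<longleftrightarrow>
    (\<forall>\<Phi> (k::nat) \<theta>.
       \<Phi> \<in> topspace X \<rightarrow> connected_compact_sets' (hedgehog A) \<and> lsc_map X (hedgehog A) \<Phi> \<and>
       k \<ge> 1 \<and>
       \<theta> \<in> topspace X \<rightarrow> sets_card_le k (hedgehog A) \<and> usc_map X (hedgehog A) \<theta> \<and>
       submap X \<theta> \<Phi> \<longrightarrow>
       (\<exists>\<phi>. \<phi> \<in> topspace X \<rightarrow> connected_compact_sets (hedgehog A) \<and>
            continuous_set_map X (hedgehog A) \<phi> \<and>
            submap X \<theta> \<phi> \<and> submap X \<phi> \<Phi>))"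
    (is "_ \<longleftrightarrow> (\<forall>\<Phi> k \<theta>. ?hyp \<Phi> k \<theta> \<longrightarrow> ?concl \<Phi> \<theta>)")
proof
  assume X: "collectionwise_normal \<tau> X"
  have A: "|A| \<le>o \<tau>" using assms(2) by (rule ordIso_imp_ordLeq)
  have "infinite (Field \<tau>)" using assms(1) by (simp add: cinfinite_def)
  moreover have "|A| =o |Field \<tau>|"
    using assms(1,2) card_of_Field_ordIso ordIso_symmetric ordIso_transitive by blast
  ultimately have "infinite A" using card_of_ordIso_finite by blast
  show "\<forall>\<Phi> k \<theta>. ?hyp \<Phi> k \<theta> \<longrightarrow> ?concl \<Phi> \<theta>"
  proof (intro allI impI, elim conjE)
    fix \<Phi> \<theta> and k :: nat
    assume "\<Phi> \<in> topspace X \<rightarrow> connected_compact_sets' (hedgehog A)" "lsc_map X (hedgehog A) \<Phi>"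
      "\<theta> \<in> topspace X \<rightarrow> sets_card_le k (hedgehog A)" "usc_map X (hedgehog A) \<theta>" "submap X \<theta> \<Phi>"
    then show "?concl \<Phi> \<theta>"
      using collectionwise_normal_imp_sandwich[OF assms(1) \<open>infinite A\<close> A X] by metis
  qed
next
  assume b: "\<forall>\<Phi> k \<theta>. ?hyp \<Phi> k \<theta> \<longrightarrow> ?concl \<Phi> \<theta>"
  show "collectionwise_normal \<tau> X"
  proof (rule sandwich_imp_collectionwise_normal)
    show "\<tau> \<le>o |A|" using assms(2) by (simp add: ordIso_iff_ordLeq)
  \<comment> \<open>The values of the constructed \<open>\<theta>\<close> have at most two points,
    hence the instance \<open>k = 2\<close>.\<close>
  qed (rule b[rule_format, of _ 2], simp)
qed

end
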